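(* Let $\sigma$ be a triangulation of a polygon $P$ with $n\ge3$ vertices, with frozen Jacobian algebra $\Gamma_\sigma$ (an $R$-algebra via $x\mapsto C$). There is an isomorphism of $R$-orders $\Lambda\cong e_F\Gamma_\sigma e_F$ such that, regarding $e_F\Gamma_\sigma$ as a left $\Lambda$-module through it, for every edge $(P_s,P_t)$ of $\sigma$ with $1\le s<t\le n$ and the corresponding vertex $j$ of $Q_\sigma$, one has $e_F\Gamma_\sigma e_j\cong (s,t)$ as $\Lambda$-modules.
   Context: Let $K$ be a field, $R=K[x]$. Let $P$ be a regular polygon with vertices $P_1,\dots,P_n$ ($n\ge3$) labelled counterclockwise and $\sigma$ a triangulation (maximal set of pairwise non-crossing diagonals; edges of $\sigma$ = sides of $P$ and diagonals of $\sigma$; an edge joining $P_s,P_t$ is written $(P_s,P_t)$). The quiver $Q_\sigma$: vertices = edges of $\sigma$; internal arrow $a\to b$ whenever $a,b$ are sides of a common triangle and $a$ precedes $b$ anticlockwise around their common vertex; external arrow $a\to b$ between the two sides of $P$ at each vertex of $P$ incident to some diagonal, $a$ preceding $b$ anticlockwise. Minimal cycles: cyclic triangles (three internal arrows in a triangle) and big cycles (internal arrows and one external arrow around a vertex of $P$). $W_\sigma=\sum$cyclic triangles $-\sum$big cycles; $F$ = vertices corresponding to sides of $P$; $\Gamma_\sigma=KQ_\sigma/J$ with $J$ generated by cyclic derivatives $\partial_aW_\sigma$ for arrows $a$ with source or target not in $F$. $e_i$ = idempotent at vertex $i$, $e_F=\sum_{i\in F}e_i$. All minimal cycles through $i$ are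 equal in $\Gamma_\sigma$, with class $C_i$; $C=\sum_iC_i$, and $R$ acts via $x\mapsto C$. $\Lambda\subset M_n(K(x))$ is the tiled order with $(i,j)$ entry $x^{c_{ij}}R$, $c_{ij}=0$ for $i\le j$, $(i,j)\neq(1,n)$; $c_{1n}=-1$; $c_{ij}=1$ if $i=j+1$; $c_{ij}=2$ if $i\ge j+2$. For $1\le s<t\le n$, $(s,t)$ denotes the left $\Lambda$-module of column vectors $[R\cdots R\ (x)\cdots(x)\ (x^2)\cdots(x^2)]^t\subset K(x)^n$ with $s$ entries in $R$, then $t-s$ entries in $xR$, then $n-t$ entries in $x^2R$, with $\Lambda$ acting by matrix multiplication. *)

theory Defs
  imports "HOL-Computational_Algebra.Polynomial" "HOL-Computational_Algebra.Fraction_Field"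
begin

text \<open>Vertices of the polygon are 1..n (counterclockwise). An edge joining P_s, P_t with s < t is the pair (s,t).\<close>

type_synonym edge = "nat \<times> nat"

definition is_side :: "nat \<Rightarrow> edge \<Rightarrow> bool" where
  "is_side n e \<longleftrightarrow> (case e of (s,t) \<Rightarrow> 1 \<le> s \<and> t \<le> n \<and> (t = s + 1 \<or> (s = 1 \<and> t = n)))"

definition is_diagonal :: "nat \<Rightarrow> edge \<Rightarrow> bool" where
  "is_diagonal n e \<longleftrightarrow> (case e of (s,t) \<Rightarrow> 1 \<le> s \<and> s + 1 < t \<and> t \<le> n \<and> \<not> (s = 1 \<and> t = n))"

definition crossing :: "edge \<Rightarrow> edge \<Rightarrow> bool" where
  "crossing d e \<longleftrightarrow> (case d of (a,b) \<Rightarrow> case e of (c,d') \<Rightarrow>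
      (a < c \<and> c < b \<and> b < d') \<or> (c < a \<and> a < d' \<and> d' < b))"

definition is_triangulation :: "nat \<Rightarrow> edge set \<Rightarrow> bool" where
  "is_triangulation n D \<longleftrightarrow>
     D \<subseteq> {d. is_diagonal n d} \<and>
     (\<forall>d\<in>D. \<forall>e\<in>D. \<not> crossing d e) \<and>
     (\<forall>d. is_diagonal n d \<and> d \<notin> D \<longrightarrow> (\<exists>e\<in>D. crossing d e))"

text \<open>Edges of the triangulation = sides of P and diagonals of sigma; these are the vertices of the quiver.\<close>
definition edges :: "nat \<Rightarrow> edge set \<Rightarrow> edge set" where
  "edges n D = {e. is_side n e} \<union> D"

definition frozen :: "nat \<Rightarrow> edge set" where
  "frozen n = {e. is_side n e}"

definition is_triangle :: "nat \<Rightarrow> edge set \<Rightarrow> nat \<Rightarrow> nat \<Rightarrow> nat \<Rightarrow> bool" where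
  "is_triangle n D u v w \<longleftrightarrow> u < v \<and> v < w \<and>
     (u,v) \<in> edges n D \<and> (v,w) \<in> edges n D \<and> (u,w) \<in> edges n D"

datatype arrow = IArr edge edge | EArr edge edge

fun asrc :: "arrow \<Rightarrow> edge" where
  "asrc (IArr a b) = a" | "asrc (EArr a b) = a"

fun atgt :: "arrow \<Rightarrow> edge" where
  "atgt (IArr a b) = b" | "atgt (EArr a b) = b"

text \<open>Internal arrows. In a triangle with vertices u<v<w (counterclockwise), going anticlockwise
  around u the side (u,v) precedes (u,w), around v the side (v,w) precedes (u,v), around w the
  side (u,w) precedes (v,w).\<close>
definition internal_arrows :: "nat \<Rightarrow> edge set \<Rightarrow> arrow set" where
  "internal_arrows n D =
     {IArr (u,v) (u,w) | u v w. is_triangle n D u v w} \<union>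
     {IArr (u,w) (v,w) | u v w. is_triangle n D u v w} \<union>
     {IArr (v,w) (u,v) | u v w. is_triangle n D u v w}"

definition prev_side :: "nat \<Rightarrow> nat \<Rightarrow> edge" where
  "prev_side n i = (if i = 1 then (1,n) else (i - 1, i))"

definition next_side :: "nat \<Rightarrow> nat \<Rightarrow> edge" where
  "next_side n i = (if i = n then (1,n) else (i, i + 1))"

definition incident_diag :: "edge set \<Rightarrow> nat \<Rightarrow> bool" where
  "incident_diag D i \<longleftrightarrow> (\<exists>d\<in>D. i = fst d \<or> i = snd d)"

text \<open>External arrows: at a vertex P_i incident to a diagonal, from the side (P_{i-1},P_i) to
  the side (P_i,P_{i+1}) (anticlockwise through the exterior angle).\<close>
definition external_arrows :: "nat \<Rightarrow> edge set \<Rightarrow> arrow set" where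
  "external_arrows n D =
     {EArr (prev_side n i) (next_side n i) | i. 1 \<le> i \<and> i \<le> n \<and> incident_diag D i}"

definition arrows :: "nat \<Rightarrow> edge set \<Rightarrow> arrow set" where
  "arrows n D = internal_arrows n D \<union> external_arrows n D"

text \<open>A path is a start vertex with a list of arrows, composed left to right (first arrow first).\<close>
type_synonym path = "edge \<times> arrow list"

fun chain :: "edge \<Rightarrow> arrow list \<Rightarrow> bool" where
  "chain v [] = True"
| "chain v (a # as) = (asrc a = v \<and> chain (atgt a) as)"

fun pend :: "edge \<Rightarrow> arrow list \<Rightarrow> edge" where
  "pend v [] = v"
| "pend v (a # as) = pend (atgt a) as"

definition is_path :: "nat \<Rightarrow> edge set \<Rightarrow> path \<Rightarrow> bool" where
  "is_path n D p \<longleftrightarrow> fst p \<in> edges n D \<and> set (snd p) \<subseteq> arrows n D \<and> chain (fst p) (snd p)"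

definition KQ :: "nat \<Rightarrow> edge set \<Rightarrow> (path \<Rightarrow> 'a::field) set" where
  "KQ n D = {f. finite {p. f p \<noteq> 0} \<and> (\<forall>p. f p \<noteq> 0 \<longrightarrow> is_path n D p)}"

definition kq_add :: "(path \<Rightarrow> 'a::field) \<Rightarrow> (path \<Rightarrow> 'a) \<Rightarrow> path \<Rightarrow> 'a" where
  "kq_add f g = (\<lambda>p. f p + g p)"

definition kq_diff :: "(path \<Rightarrow> 'a::field) \<Rightarrow> (path \<Rightarrow> 'a) \<Rightarrow> path \<Rightarrow> 'a" where
  "kq_diff f g = (\<lambda>p. f p - g p)"

definition kq_mult :: "(path \<Rightarrow> 'a::field) \<Rightarrow> (path \<Rightarrow> 'a) \<Rightarrow> path \<Rightarrow> 'a" where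
  "kq_mult f g = (\<lambda>p. \<Sum>k\<le>length (snd p).
      f (fst p, take k (snd p)) * g (pend (fst p) (take k (snd p)), drop k (snd p)))"

definition kq_basis :: "path \<Rightarrow> path \<Rightarrow> 'a::field" where
  "kq_basis p = (\<lambda>q. if q = p then 1 else 0)"

definition idem :: "edge set \<Rightarrow> path \<Rightarrow> 'a::field" where
  "idem A = (\<lambda>q. if snd q = [] \<and> fst q \<in> A then 1 else 0)"

definition tri_cycles :: "nat \<Rightarrow> edge set \<Rightarrow> arrow list set" where
  "tri_cycles n D = {[IArr (u,v) (u,w), IArr (u,w) (v,w), IArr (v,w) (u,v)] | u v w. is_triangle n D u v w}"

definition big_cycles :: "nat \<Rightarrow> edge set \<Rightarrow> arrow list set" where
  "big_cycles n D = {EArr (prev_side n i) (next_side n i) # as | i as.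
      1 \<le> i \<and> i \<le> n \<and> incident_diag D i \<and> as \<noteq> [] \<and>
      (\<forall>a\<in>set as. a \<in> internal_arrows n D \<and> i \<in> {fst (asrc a), snd (asrc a)} \<and> i \<in> {fst (atgt a), snd (atgt a)}) \<and>
      chain (next_side n i) as \<and> pend (next_side n i) as = prev_side n i}"

definition min_cycles :: "nat \<Rightarrow> edge set \<Rightarrow> arrow list set" where
  "min_cycles n D = tri_cycles n D \<union> big_cycles n D"

text \<open>Cyclic derivative of a cycle c with respect to an arrow a, as list of paths (one per occurrence).\<close>
definition cder :: "arrow list \<Rightarrow> arrow \<Rightarrow> path list" where
  "cder c a = map (\<lambda>i. (atgt a, take (length c - 1) (rotate (Suc i) c)))
                  (filter (\<lambda>i. c ! i = a) [0..<length c])"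

text \<open>partial_a W for W = sum of cyclic triangles - sum of big cycles.\<close>
definition dW :: "nat \<Rightarrow> edge set \<Rightarrow> arrow \<Rightarrow> path \<Rightarrow> 'a::field" where
  "dW n D a = (\<lambda>p. of_nat (\<Sum>c\<in>tri_cycles n D. count_list (cder c a) p)
                 - of_nat (\<Sum>c\<in>big_cycles n D. count_list (cder c a) p))"

definition kq_ideal :: "nat \<Rightarrow> edge set \<Rightarrow> (path \<Rightarrow> 'a::field) set \<Rightarrow> (path \<Rightarrow> 'a) set" where
  "kq_ideal n D S = \<Inter>{I. S \<subseteq> I \<and> I \<subseteq> KQ n D \<and> (\<lambda>p. 0) \<in> I \<and>
       (\<forall>f\<in>I. \<forall>g\<in>I. kq_add f g \<in> I) \<and> (\<forall>c. \<forall>f\<in>I. (\<lambda>p. c * f p) \<in> I) \<and>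
       (\<forall>f\<in>I. \<forall>g\<in>KQ n D. kq_mult g f \<in> I \<and> kq_mult f g \<in> I)}"

definition Jideal :: "nat \<Rightarrow> edge set \<Rightarrow> (path \<Rightarrow> 'a::field) set" where
  "Jideal n D = kq_ideal n D
     {dW n D a | a. a \<in> arrows n D \<and> (asrc a \<notin> frozen n \<or> atgt a \<notin> frozen n)}"

text \<open>Equality in Gamma_sigma = KQ/J.\<close>
definition gam_eq :: "nat \<Rightarrow> edge set \<Rightarrow> (path \<Rightarrow> 'a::field) \<Rightarrow> (path \<Rightarrow> 'a) \<Rightarrow> bool" where
  "gam_eq n D f g \<longleftrightarrow> kq_diff f g \<in> Jideal n D"

text \<open>Representatives of e_A Gamma e_B inside KQ.\<close>
definition corner :: "nat \<Rightarrow> edge set \<Rightarrow> edge set \<Rightarrow> edge set \<Rightarrow> (path \<Rightarrow> 'a::field) set" where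
  "corner n D A B = {kq_mult (kq_mult (idem A) g) (idem B) | g. g \<in> KQ n D}"

text \<open>A chosen minimal cycle through vertex v (starting at v); all such are equal in Gamma.\<close>
definition Cpath :: "nat \<Rightarrow> edge set \<Rightarrow> edge \<Rightarrow> path" where
  "Cpath n D v = (SOME p. \<exists>c k. c \<in> min_cycles n D \<and> k < length c \<and>
       asrc (rotate k c ! 0) = v \<and> p = (v, rotate k c))"

definition Cel :: "nat \<Rightarrow> edge set \<Rightarrow> path \<Rightarrow> 'a::field" where
  "Cel n D = (\<lambda>q. \<Sum>v\<in>edges n D. kq_basis (Cpath n D v) q)"

fun kq_pow :: "nat \<Rightarrow> edge set \<Rightarrow> (path \<Rightarrow> 'a::field) \<Rightarrow> nat \<Rightarrow> path \<Rightarrow> 'a" where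
  "kq_pow n D g 0 = idem (edges n D)"
| "kq_pow n D g (Suc k) = kq_mult g (kq_pow n D g k)"

definition kq_smul_poly :: "nat \<Rightarrow> edge set \<Rightarrow> 'a::field poly \<Rightarrow> (path \<Rightarrow> 'a) \<Rightarrow> path \<Rightarrow> 'a" where
  "kq_smul_poly n D r g = (\<lambda>p. \<Sum>k\<le>degree r. coeff r k * kq_mult (kq_pow n D (Cel n D) k) g p)"

definition xR :: "int \<Rightarrow> 'a::field poly fract set" where
  "xR k = {Fract p 1 * (if k \<ge> 0 then Fract (monom 1 (nat k)) 1 else inverse (Fract (monom 1 (nat (- k))) 1)) | p. True}"

definition c_exp :: "nat \<Rightarrow> nat \<Rightarrow> nat \<Rightarrow> int" where
  "c_exp n i j = (if i = 1 \<and> j = n then -1 else if i \<le> j then 0 else if i = j + 1 then 1 else 2)"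

definition Lambda :: "nat \<Rightarrow> (nat \<Rightarrow> nat \<Rightarrow> 'a::field poly fract) set" where
  "Lambda n = {M. (\<forall>i j. M i j \<noteq> 0 \<longrightarrow> i \<in> {1..n} \<and> j \<in> {1..n}) \<and>
                  (\<forall>i\<in>{1..n}. \<forall>j\<in>{1..n}. M i j \<in> xR (c_exp n i j))}"

definition madd :: "(nat \<Rightarrow> nat \<Rightarrow> 'a::field) \<Rightarrow> (nat \<Rightarrow> nat \<Rightarrow> 'a) \<Rightarrow> nat \<Rightarrow> nat \<Rightarrow> 'a" where
  "madd M N = (\<lambda>i j. M i j + N i j)"

definition mmult :: "nat \<Rightarrow> (nat \<Rightarrow> nat \<Rightarrow> 'a::field) \<Rightarrow> (nat \<Rightarrow> nat \<Rightarrow> 'a) \<Rightarrow> nat \<Rightarrow> nat \<Rightarrow> 'a" where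
  "mmult n M N = (\<lambda>i j. \<Sum>k\<in>{1..n}. M i k * N k j)"

definition mone :: "nat \<Rightarrow> nat \<Rightarrow> nat \<Rightarrow> 'a::field" where
  "mone n = (\<lambda>i j. if i = j \<and> i \<in> {1..n} then 1 else 0)"

definition msmul :: "'a::field poly \<Rightarrow> (nat \<Rightarrow> nat \<Rightarrow> 'a poly fract) \<Rightarrow> nat \<Rightarrow> nat \<Rightarrow> 'a poly fract" where
  "msmul r M = (\<lambda>i j. Fract r 1 * M i j)"

definition stmod :: "nat \<Rightarrow> nat \<Rightarrow> nat \<Rightarrow> (nat \<Rightarrow> 'a::field poly fract) set" where
  "stmod n s t = {v. (\<forall>i. v i \<noteq> 0 \<longrightarrow> i \<in> {1..n}) \<and>
      (\<forall>i\<in>{1..n}. v i \<in> xR (if i \<le> s then 0 else if i \<le> t then 1 else 2))}"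

definition vadd :: "(nat \<Rightarrow> 'a::field) \<Rightarrow> (nat \<Rightarrow> 'a) \<Rightarrow> nat \<Rightarrow> 'a" where
  "vadd v w = (\<lambda>i. v i + w i)"

definition mvec :: "nat \<Rightarrow> (nat \<Rightarrow> nat \<Rightarrow> 'a::field) \<Rightarrow> (nat \<Rightarrow> 'a) \<Rightarrow> nat \<Rightarrow> 'a" where
  "mvec n M v = (\<lambda>i. \<Sum>k\<in>{1..n}. M i k * v k)"

text \<open>phi : Lambda -> e_F Gamma e_F (given on representatives in KQ) is an isomorphism of R-algebras.\<close>
definition R_order_iso :: "nat \<Rightarrow> edge set \<Rightarrow> ((nat \<Rightarrow> nat \<Rightarrow> 'a::field poly fract) \<Rightarrow> (path \<Rightarrow> 'a)) \<Rightarrow> bool" where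
  "R_order_iso n D \<phi> \<longleftrightarrow>
     (\<forall>L\<in>Lambda n. \<phi> L \<in> corner n D (frozen n) (frozen n)) \<and>
     (\<forall>L\<in>Lambda n. \<forall>M\<in>Lambda n. gam_eq n D (\<phi> (madd L M)) (kq_add (\<phi> L) (\<phi> M))) \<and>
     (\<forall>L\<in>Lambda n. \<forall>M\<in>Lambda n. gam_eq n D (\<phi> (mmult n L M)) (kq_mult (\<phi> L) (\<phi> M))) \<and>
     gam_eq n D (\<phi> (mone n)) (idem (frozen n)) \<and>
     (\<forall>r. \<forall>L\<in>Lambda n. gam_eq n D (\<phi> (msmul r L)) (kq_smul_poly n D r (\<phi> L))) \<and>
     (\<forall>L\<in>Lambda n. \<forall>M\<in>Lambda n. gam_eq n D (\<phi> L) (\<phi> M) \<longrightarrow> L = M) \<and>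
     (\<forall>g\<in>corner n D (frozen n) (frozen n). \<exists>L\<in>Lambda n. gam_eq n D g (\<phi> L))"

definition module_iso :: "nat \<Rightarrow> edge set \<Rightarrow> ((nat \<Rightarrow> nat \<Rightarrow> 'a::field poly fract) \<Rightarrow> (path \<Rightarrow> 'a))
     \<Rightarrow> nat \<Rightarrow> nat \<Rightarrow> ((nat \<Rightarrow> 'a poly fract) \<Rightarrow> (path \<Rightarrow> 'a)) \<Rightarrow> bool" where
  "module_iso n D \<phi> s t \<psi> \<longleftrightarrow>
     (\<forall>v\<in>stmod n s t. \<psi> v \<in> corner n D (frozen n) {(s,t)}) \<and>
     (\<forall>v\<in>stmod n s t. \<forall>w\<in>stmod n s t. gam_eq n D (\<psi> (vadd v w)) (kq_add (\<psi> v) (\<psi> w))) \<and>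
     (\<forall>L\<in>Lambda n. \<forall>v\<in>stmod n s t. gam_eq n D (\<psi> (mvec n L v)) (kq_mult (\<phi> L) (\<psi> v))) \<and>
     (\<forall>v\<in>stmod n s t. \<forall>w\<in>stmod n s t. gam_eq n D (\<psi> v) (\<psi> w) \<longrightarrow> v = w) \<and>
     (\<forall>g\<in>corner n D (frozen n) {(s,t)}. \<exists>v\<in>stmod n s t. gam_eq n D g (\<psi> v))"

end

theory Submission
  imports Defs "HOL-Computational_Algebra.Polynomial_Factorial"
begin

text \<open>
  Give an arrow weight 1 if it decreases one of the endpoints of an edge and weight 0 otherwise.
  Every minimal cycle has weight 1, so the relations are homogeneous, and sending a path \<open>p\<close> from
  \<open>d\<close> to \<open>e\<close> to \<open>x\<close> to the power weight of \<open>p\<close> in entry \<open>(d, e)\<close> is a homomorphism from the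
  frozen Jacobian algebra to matrices over \<open>K[x]\<close>. In the universal cover of the quiver, edges
  become pairs \<open>(a, b)\<close> with \<open>a < b < a + n\<close>, all arrows are increasing, and \<open>(a, b) \<mapsto> (b, a + n)\<close>
  raises the weight by one; hence the side \<open>i\<close> is joined to \<open>(s, t)\<close> by paths of exactly those
  weights prescribed by the rows of the module \<open>(s, t)\<close>.

  The crux is that two paths of the same weight from a side to an edge are equal in the algebra.
  If their last arrows \<open>x\<close> and \<open>y\<close> into \<open>e = {a, b}\<close> differ, one of them turns around \<open>a\<close> and the
  other lies in the triangle \<open>a, b, c\<close>. The relation of the arrow from \<open>{a, b}\<close> to \<open>{a, c}\<close> then
  identifies two paths from \<open>{a, c}\<close> to \<open>e\<close> ending in \<open>x\<close> and \<open>y\<close>. The endpoint \<open>a\<close> can be chosen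
  so that \<open>{a, c}\<close> is reached from the side early enough, and induction applies.
\<close>

text \<open>Call \<open>(s, t)\<close> with \<open>s < t\<close> the lift of level 0 of an edge,
  \<open>(t, s + n)\<close> that of level 1, \<open>(s + n, t + n)\<close> that of level 2, and so
  on. The weight of an arrow is the number of levels it climbs, and side \<open>i\<close> reaches
  just the lifts whose smaller coordinate is at least \<open>i\<close>. The exponent
  \<open>-1\<close> in \<open>c_exp\<close> comes from the side \<open>(1, n)\<close>, which as side
  number \<open>n\<close> must be lifted to \<open>(n, n + 1)\<close>, one level higher. The weight
  matrices therefore form an order that becomes \<open>Lambda n\<close> only after conjugation by
  the diagonal matrix with entries 1, ..., 1, x. The obstacle in the crux is that
  \<open>{a, c}\<close> may be out of reach of the side with the weight that is left. Turning about
  the endpoint that is the smaller coordinate of the lift of \<open>e\<close> avoids this, so the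
  choice depends on the level. For a side \<open>e\<close> of the polygon the endpoint is forced,
  and the bounds for both arrows are used. All computations go from path algebra elements to
  matrices; the isomorphisms pick preimages, which are unique modulo the ideal.\<close>

section \<open>The path algebra and its weight grading\<close>

text \<open>Keeps statements about paths from being rewritten into statements about nested tuples.\<close>
declare split_paired_All [simp del] split_paired_Ex [simp del]

abbreviation (input) ptgt :: "path \<Rightarrow> edge" where
  "ptgt p \<equiv> pend (fst p) (snd p)"

lemma chain_append [simp]: "chain v (xs @ ys) \<longleftrightarrow> chain v xs \<and> chain (pend v xs) ys"
  by (induction xs arbitrary: v) auto

lemma pend_append [simp]: "pend v (xs @ ys) = pend (pend v xs) ys"
  by (induction xs arbitrary: v) auto

section \<open>Idempotents and corners\<close>

lemma kq_mult_idem_left: "kq_mult (idem A) g = (\<lambda>p. if fst p \<in> A then g p else (0::'a::field))"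
proof
  fix p :: path
  have "kq_mult (idem A) g p = (\<Sum>k\<le>length (snd p). if k = 0 then (if fst p \<in> A then g p else 0) else 0)"
    unfolding kq_mult_def idem_def by (rule sum.cong) auto
  then show "kq_mult (idem A) g p = (if fst p \<in> A then g p else 0)" by simp
qed

lemma kq_mult_idem_right: "kq_mult g (idem B) = (\<lambda>p. if ptgt p \<in> B then g p else (0::'a::field))"
proof
  fix p :: path
  have "kq_mult g (idem B) p =
      (\<Sum>k\<le>length (snd p). if k = length (snd p) then (if ptgt p \<in> B then g p else 0) else 0)"
    unfolding kq_mult_def idem_def by (rule sum.cong) auto
  then show "kq_mult g (idem B) p = (if ptgt p \<in> B then g p else 0)" by simp
qed

text \<open>Replaces products with idempotents by a condition on the support: only paths from
  \<open>A\<close> to \<open>B\<close> occur.\<close>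

lemma corner_iff:
  "f \<in> corner n D A B \<longleftrightarrow> f \<in> KQ n D \<and> (\<forall>p. f p \<noteq> 0 \<longrightarrow> fst p \<in> A \<and> ptgt p \<in> B)"
proof
  assume "f \<in> corner n D A B"
  then obtain g where g: "g \<in> KQ n D" and f: "f = kq_mult (kq_mult (idem A) g) (idem B)"
    by (auto simp: corner_def)
  have "finite {p. f p \<noteq> 0}"
    by (rule finite_subset[of _ "{p. g p \<noteq> 0}"])
      (use g in \<open>auto simp: f kq_mult_idem_left kq_mult_idem_right KQ_def split: if_splits\<close>)
  with g show "f \<in> KQ n D \<and> (\<forall>p. f p \<noteq> 0 \<longrightarrow> fst p \<in> A \<and> ptgt p \<in> B)"
    by (auto simp: f kq_mult_idem_left kq_mult_idem_right KQ_def split: if_splits)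
next
  assume f: "f \<in> KQ n D \<and> (\<forall>p. f p \<noteq> 0 \<longrightarrow> fst p \<in> A \<and> ptgt p \<in> B)"
  then have "f = kq_mult (kq_mult (idem A) f) (idem B)"
    by (auto simp: kq_mult_idem_left kq_mult_idem_right fun_eq_iff)
  with f show "f \<in> corner n D A B" by (auto simp: corner_def)
qed

section \<open>Linear structure and products of paths\<close>

lemma KQ_zero: "(\<lambda>p. 0) \<in> KQ n D"
  by (simp add: KQ_def)

lemma KQ_add: "f \<in> KQ n D \<Longrightarrow> g \<in> KQ n D \<Longrightarrow> (\<lambda>p. f p + g p) \<in> KQ n D"
  by (force simp: KQ_def intro: finite_subset[of _ "{p. f p \<noteq> 0} \<union> {p. g p \<noteq> 0}"])

lemma KQ_smult: "f \<in> KQ n D \<Longrightarrow> (\<lambda>p. c * f p) \<in> KQ n D"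
  by (auto simp: KQ_def intro: finite_subset[of _ "{p. f p \<noteq> 0}"])

lemma KQ_diff: "f \<in> KQ n D \<Longrightarrow> g \<in> KQ n D \<Longrightarrow> (\<lambda>p. f p - g p) \<in> KQ n D"
  using KQ_add[of f n D "\<lambda>p. (-1) * g p"] KQ_smult[of g n D "-1"] by simp

lemma KQ_sum: "(\<And>i. i \<in> A \<Longrightarrow> f i \<in> KQ n D) \<Longrightarrow> (\<lambda>p. \<Sum>i\<in>A. f i p) \<in> KQ n D"
  by (induction A rule: infinite_finite_induct) (auto simp: KQ_zero intro!: KQ_add)

lemma KQ_basis: "is_path n D p \<Longrightarrow> (kq_basis p :: _ \<Rightarrow> 'a::field) \<in> KQ n D"
  by (auto simp: KQ_def kq_basis_def intro: finite_subset[of _ "{p}"] split: if_splits)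

text \<open>Reduces statements that are linear in an element to single paths. The induction runs
  over a finite set containing the support, so a point removed from it may have coefficient
  0.\<close>

lemma KQ_induct [consumes 1, case_names zero add]:
  assumes f: "(f :: path \<Rightarrow> 'a::field) \<in> KQ n D"
    and zero: "P (\<lambda>p. 0)"
    and add: "\<And>c p g. is_path n D p \<Longrightarrow> g \<in> KQ n D \<Longrightarrow> P g \<Longrightarrow> P (\<lambda>q. c * kq_basis p q + g q)"
  shows "P f"
proof -
  have "finite S \<Longrightarrow> {p. f p \<noteq> 0} \<subseteq> S \<Longrightarrow> f \<in> KQ n D \<Longrightarrow> P f" for S f
  proof (induction S arbitrary: f rule: finite_induct)
    case empty
    then have "f = (\<lambda>p. 0)" by auto
    then show ?case using zero by simp
  next
    case (insert x S)
    show ?case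
    proof (cases "f x = 0")
      case True
      with insert show ?thesis by blast
    next
      case False
      let ?g = "f(x := 0)"
      have g: "?g \<in> KQ n D"
        using insert.prems(2) by (auto simp: KQ_def intro: finite_subset[of _ "{p. f p \<noteq> 0}"])
      have "P ?g" using insert.prems by (intro insert.IH g) auto
      moreover have "is_path n D x" using False insert.prems(2) by (simp add: KQ_def)
      moreover have "f = (\<lambda>q. f x * kq_basis x q + ?g q)" by (auto simp: kq_basis_def)
      ultimately show ?thesis using add[OF _ g, of x "f x"] by simp
    qed
  qed
  with f show ?thesis by (auto simp: KQ_def)
qed

lemma kq_mult_add_left:
  "kq_mult (\<lambda>p. f p + g p) h = (\<lambda>p. kq_mult f h p + kq_mult g h p)"
  by (simp add: kq_mult_def algebra_simps sum.distrib)

lemma kq_mult_add_right: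
  "kq_mult h (\<lambda>p. f p + g p) = (\<lambda>p. kq_mult h f p + kq_mult h g p)"
  by (simp add: kq_mult_def algebra_simps sum.distrib)

lemma kq_mult_diff_left:
  "kq_mult (\<lambda>p. f p - g p) h = (\<lambda>p. kq_mult f h p - kq_mult g h p)"
  by (simp add: kq_mult_def algebra_simps sum_subtractf)

lemma kq_mult_diff_right:
  "kq_mult h (\<lambda>p. f p - g p) = (\<lambda>p. kq_mult h f p - kq_mult h g p)"
  by (simp add: kq_mult_def algebra_simps sum_subtractf)

lemma kq_mult_smult_left: "kq_mult (\<lambda>p. c * f p) h = (\<lambda>p. c * kq_mult f h p)"
  by (simp add: kq_mult_def algebra_simps sum_distrib_left)

lemma kq_mult_smult_right: "kq_mult h (\<lambda>p. c * f p) = (\<lambda>p. c * kq_mult h f p)"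
  by (simp add: kq_mult_def algebra_simps sum_distrib_left)

lemma kq_mult_zero_left: "kq_mult (\<lambda>p. 0) h = (\<lambda>p. 0)"
  and kq_mult_zero_right: "kq_mult h (\<lambda>p. 0) = (\<lambda>p. 0)"
  by (simp_all add: kq_mult_def)

lemma kq_mult_nonzeroD:
  assumes "kq_mult f g p \<noteq> 0"
  obtains as bs where "snd p = as @ bs" "f (fst p, as) \<noteq> 0" "g (pend (fst p) as, bs) \<noteq> 0"
proof -
  obtain k where "f (fst p, take k (snd p)) * g (pend (fst p) (take k (snd p)), drop k (snd p)) \<noteq> 0"
    using assms unfolding kq_mult_def by (metis (no_types, lifting) sum.neutral)
  then show ?thesis using that[of "take k (snd p)" "drop k (snd p)"] by auto
qed

text \<open>Of all ways to cut a path in two, only the cut at the length of \<open>p\<close> can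
  contribute.\<close>

lemma kq_mult_basis:
  "kq_mult (kq_basis p) (kq_basis q :: _ \<Rightarrow> 'a::field) =
     (if ptgt p = fst q then kq_basis (fst p, snd p @ snd q) else (\<lambda>_. 0))"
proof
  fix r :: path
  have eq: "(kq_basis p (fst r, take k (snd r)) *
      kq_basis q (pend (fst r) (take k (snd r)), drop k (snd r)) :: 'a) =
      (if k = length (snd p) then (if ptgt p = fst q \<and> r = (fst p, snd p @ snd q) then 1 else 0) else 0)"
    if k: "k \<le> length (snd r)" for k
  proof (cases "fst r = fst p \<and> take k (snd r) = snd p")
    case True
    with k have len: "k = length (snd p)" by (metis length_take min.absorb2)
    have "r = (fst p, snd p @ snd q) \<longleftrightarrow> drop k (snd r) = snd q"
      using True by (metis append_take_drop_id prod.collapse fst_conv snd_conv same_append_eq)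
    moreover have "kq_basis p (fst r, take k (snd r)) = (1::'a)" using True by (simp add: kq_basis_def)
    moreover have "kq_basis q (pend (fst r) (take k (snd r)), drop k (snd r)) =
        (if ptgt p = fst q \<and> drop k (snd r) = snd q then 1 else (0::'a))"
    proof -
      have "(pend (fst r) (take k (snd r)), drop k (snd r)) = q \<longleftrightarrow> ptgt p = fst q \<and> drop k (snd r) = snd q"
        using True by (cases q) auto
      then show ?thesis unfolding kq_basis_def by simp
    qed
    ultimately show ?thesis using len by simp
  next
    case False
    then have "kq_basis p (fst r, take k (snd r)) = (0::'a)" by (auto simp: kq_basis_def)
    moreover have "\<not> (k = length (snd p) \<and> r = (fst p, snd p @ snd q))" using False by auto
    ultimately show ?thesis by auto
  qed
  have "kq_mult (kq_basis p) (kq_basis q :: _ \<Rightarrow> 'a) r =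
      (\<Sum>k\<le>length (snd r). if k = length (snd p)
         then (if ptgt p = fst q \<and> r = (fst p, snd p @ snd q) then 1 else 0) else 0)"
    unfolding kq_mult_def by (rule sum.cong) (use eq in auto)
  also have "\<dots> = (if ptgt p = fst q then kq_basis (fst p, snd p @ snd q) else (\<lambda>_. 0)) r"
    by (auto simp: kq_basis_def)
  finally show "kq_mult (kq_basis p) (kq_basis q :: _ \<Rightarrow> 'a) r =
    (if ptgt p = fst q then kq_basis (fst p, snd p @ snd q) else (\<lambda>_. 0)) r" .
qed

lemma is_path_append:
  "is_path n D p \<Longrightarrow> is_path n D q \<Longrightarrow> ptgt p = fst q \<Longrightarrow> is_path n D (fst p, snd p @ snd q)"
  by (auto simp: is_path_def)

lemma KQ_mult:
  assumes f: "(f :: path \<Rightarrow> 'a::field) \<in> KQ n D" and g: "g \<in> KQ n D"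
  shows "kq_mult f g \<in> KQ n D"
  using f
proof (induction f rule: KQ_induct)
  case zero
  then show ?case by (simp add: kq_mult_zero_left KQ_zero)
next
  case (add c p f)
  have "kq_mult (kq_basis p) g \<in> KQ n D"
    using g
  proof (induction g rule: KQ_induct)
    case zero
    then show ?case by (simp add: kq_mult_zero_right KQ_zero)
  next
    case (add c' q g)
    then have "kq_mult (kq_basis p) (kq_basis q :: _ \<Rightarrow> 'a) \<in> KQ n D"
      using \<open>is_path n D p\<close> by (auto simp: kq_mult_basis KQ_zero intro!: KQ_basis is_path_append)
    with add show ?case
      by (auto simp: kq_mult_add_right kq_mult_smult_right intro!: KQ_add KQ_smult)
  qed
  with add show ?case
    by (auto simp: kq_mult_add_left kq_mult_smult_left intro!: KQ_add KQ_smult)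
qed

section \<open>The weight homomorphism\<close>

definition arrow_wt :: "arrow \<Rightarrow> nat" where
  "arrow_wt a = (if fst (atgt a) < fst (asrc a) \<or> snd (atgt a) < snd (asrc a) then 1 else 0)"

definition wt :: "arrow list \<Rightarrow> nat" where
  "wt as = sum_list (map arrow_wt as)"

lemma wt_simps [simp]: "wt [] = 0" "wt (a # as) = arrow_wt a + wt as" "wt (as @ bs) = wt as + wt bs"
  by (simp_all add: wt_def)

definition wt_poly :: "edge \<Rightarrow> edge \<Rightarrow> (path \<Rightarrow> 'a::field) \<Rightarrow> 'a poly" where
  "wt_poly d e f = (\<Sum>p | f p \<noteq> 0 \<and> fst p = d \<and> ptgt p = e. monom (f p) (wt (snd p)))"

text \<open>Elements have different supports; this allows their polynomials to be written as sums
  over a common index set.\<close>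

lemma wt_poly_superset:
  assumes "finite S" "{p. f p \<noteq> 0} \<subseteq> S"
  shows "wt_poly d e f = (\<Sum>p\<in>S. if fst p = d \<and> ptgt p = e then monom (f p) (wt (snd p)) else 0)"
  unfolding wt_poly_def
  by (rule sum.mono_neutral_cong_left) (use assms in auto)

lemma KQ_finite: "f \<in> KQ n D \<Longrightarrow> finite {p. f p \<noteq> 0}"
  by (simp add: KQ_def)

lemma wt_poly_zero: "wt_poly d e (\<lambda>p. 0) = 0"
  by (simp add: wt_poly_def)

lemma smult_sum_right: "smult c (\<Sum>i\<in>S. f i) = (\<Sum>i\<in>S. smult c (f i))"
  by (induction S rule: infinite_finite_induct) (auto simp: smult_add_right)

lemma wt_poly_add:
  assumes "f \<in> KQ n D" "g \<in> KQ n D"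
  shows "wt_poly d e (\<lambda>p. f p + g p) = wt_poly d e f + wt_poly d e g"
proof -
  let ?S = "{p. f p \<noteq> 0} \<union> {p. g p \<noteq> 0}"
  have S: "finite ?S" using assms by (simp add: KQ_def)
  have "wt_poly d e (\<lambda>p. f p + g p) =
      (\<Sum>p\<in>?S. if fst p = d \<and> ptgt p = e then monom (f p + g p) (wt (snd p)) else 0)"
    by (rule wt_poly_superset[OF S]) auto
  moreover have "wt_poly d e f = (\<Sum>p\<in>?S. if fst p = d \<and> ptgt p = e then monom (f p) (wt (snd p)) else 0)"
    by (rule wt_poly_superset[OF S]) auto
  moreover have "wt_poly d e g = (\<Sum>p\<in>?S. if fst p = d \<and> ptgt p = e then monom (g p) (wt (snd p)) else 0)"
    by (rule wt_poly_superset[OF S]) auto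
  ultimately show ?thesis
    by (simp only: sum.distrib[symmetric])
       (rule sum.cong, auto simp: add_monom)
qed

lemma wt_poly_smult:
  assumes "f \<in> KQ n D"
  shows "wt_poly d e (\<lambda>p. c * f p) = smult c (wt_poly d e f)"
proof -
  have "wt_poly d e (\<lambda>p. c * f p) =
      (\<Sum>p | f p \<noteq> 0. if fst p = d \<and> ptgt p = e then monom (c * f p) (wt (snd p)) else 0)"
    by (rule wt_poly_superset) (use assms in \<open>auto simp: KQ_def\<close>)
  also have "\<dots> = smult c (\<Sum>p | f p \<noteq> 0. if fst p = d \<and> ptgt p = e then monom (f p) (wt (snd p)) else 0)"
    unfolding smult_sum_right by (rule sum.cong) (auto simp: smult_monom)
  also have "(\<Sum>p | f p \<noteq> 0. if fst p = d \<and> ptgt p = e then monom (f p) (wt (snd p)) else 0) = wt_poly d e f"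
    by (rule wt_poly_superset[symmetric]) (use assms in \<open>auto simp: KQ_def\<close>)
  finally show ?thesis .
qed

lemma wt_poly_diff:
  assumes "f \<in> KQ n D" "g \<in> KQ n D"
  shows "wt_poly d e (\<lambda>p. f p - g p) = wt_poly d e f - wt_poly d e g"
  using wt_poly_add[of f n D "\<lambda>p. (-1) * g p" d e] KQ_smult[OF assms(2), of "-1"] assms
    wt_poly_smult[OF assms(2), of d e "-1"] by simp

lemma wt_poly_sum:
  "(\<And>i. i \<in> A \<Longrightarrow> f i \<in> KQ n D) \<Longrightarrow>
    wt_poly d e (\<lambda>p. \<Sum>i\<in>A. f i p) = (\<Sum>i\<in>A. wt_poly d e (f i))"
  by (induction A rule: infinite_finite_induct) (simp_all add: wt_poly_zero wt_poly_add[of _ n D] KQ_sum)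

lemma wt_poly_basis:
  "wt_poly d e (kq_basis p :: _ \<Rightarrow> 'a::field) =
     (if fst p = d \<and> ptgt p = e then monom 1 (wt (snd p)) else 0)"
  by (subst wt_poly_superset[of "{p}"]) (auto simp: kq_basis_def)

lemma coeff_wt_poly:
  "finite {p. f p \<noteq> 0} \<Longrightarrow>
    coeff (wt_poly d e f) k = (\<Sum>p | f p \<noteq> 0 \<and> fst p = d \<and> ptgt p = e \<and> wt (snd p) = k. f p)"
  unfolding wt_poly_def coeff_sum coeff_monom by (intro sum.mono_neutral_cong_right) auto

lemma pend_in_edges:
  assumes "is_path n D p" "\<And>a. a \<in> arrows n D \<Longrightarrow> atgt a \<in> edges n D"
  shows "ptgt p \<in> edges n D"
proof -
  have "v \<in> edges n D \<Longrightarrow> set as \<subseteq> arrows n D \<Longrightarrow> pend v as \<in> edges n D" for v as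
    by (induction as arbitrary: v) (use assms(2) in auto)
  with assms(1) show ?thesis by (auto simp: is_path_def)
qed

text \<open>Weights add under concatenation, so the polynomials multiply like matrices indexed by
  the edges. By bilinearity two single paths suffice, and then only the target of the first
  contributes as an intermediate edge.\<close>

lemma wt_poly_mult:
  assumes f: "(f :: path \<Rightarrow> 'a::field) \<in> KQ n D" and g: "g \<in> KQ n D"
    and fin: "finite (edges n D)" and tgt: "\<And>a. a \<in> arrows n D \<Longrightarrow> atgt a \<in> edges n D"
  shows "wt_poly d e (kq_mult f g) = (\<Sum>c\<in>edges n D. wt_poly d c f * wt_poly c e g)"
  using f
proof (induction f rule: KQ_induct)
  case zero
  then show ?case by (simp add: kq_mult_zero_left wt_poly_zero)
next
  case (add a p f)
  have p: "ptgt p \<in> edges n D" by (rule pend_in_edges) (use add tgt in auto)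
  have bp: "(kq_basis p :: _ \<Rightarrow> 'a) \<in> KQ n D" by (rule KQ_basis) fact
  have "wt_poly d e (kq_mult (kq_basis p) g) = (\<Sum>c\<in>edges n D. wt_poly d c (kq_basis p) * wt_poly c e g)"
    using g
  proof (induction g rule: KQ_induct)
    case zero
    then show ?case by (simp add: kq_mult_zero_right wt_poly_zero)
  next
    case (add b q g)
    have bq: "(kq_basis q :: _ \<Rightarrow> 'a) \<in> KQ n D" by (rule KQ_basis) fact
    have "wt_poly d e (kq_mult (kq_basis p) (kq_basis q :: _ \<Rightarrow> 'a)) =
        (if fst p = d \<and> ptgt p = fst q \<and> ptgt q = e then monom 1 (wt (snd p) + wt (snd q)) else 0)"
      unfolding kq_mult_basis
    proof (cases "ptgt p = fst q")
      case True
      then have "pend (fst p) (snd p @ snd q) = ptgt q" by simp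
      with True show "wt_poly d e (if ptgt p = fst q then kq_basis (fst p, snd p @ snd q) else (\<lambda>_. 0 :: 'a)) =
          (if fst p = d \<and> ptgt p = fst q \<and> ptgt q = e then monom 1 (wt (snd p) + wt (snd q)) else 0)"
        by (simp only: if_True wt_poly_basis fst_conv snd_conv wt_simps simp_thms)
    qed (simp add: wt_poly_zero)
    also have "\<dots> = (\<Sum>c\<in>edges n D. if ptgt p = c then wt_poly d c (kq_basis p) * wt_poly c e (kq_basis q) else 0)"
    proof -
      have "(\<Sum>c\<in>edges n D. if ptgt p = c then wt_poly d c (kq_basis p) * wt_poly c e (kq_basis q) else 0) =
          wt_poly d (ptgt p) (kq_basis p :: _ \<Rightarrow> 'a) * wt_poly (ptgt p) e (kq_basis q)"
        using p fin by simp
      then show ?thesis unfolding wt_poly_basis by (auto simp: mult_monom)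
    qed
    also have "\<dots> = (\<Sum>c\<in>edges n D. wt_poly d c (kq_basis p) * wt_poly c e (kq_basis q))"
      by (rule sum.cong) (auto simp: wt_poly_basis)
    finally have *: "wt_poly d e (kq_mult (kq_basis p) (kq_basis q :: _ \<Rightarrow> 'a)) = \<dots>" .
    show ?case
      by (simp add: kq_mult_add_right kq_mult_smult_right wt_poly_add[OF KQ_smult[OF KQ_mult[OF bp bq]] KQ_mult[OF bp add(2)]]
          wt_poly_add[OF KQ_smult[OF bq] add(2)] wt_poly_smult[OF bq] wt_poly_smult[OF KQ_mult[OF bp bq]]
          add.IH * distrib_left sum.distrib smult_sum_right)
  qed
  then show ?case
    by (simp add: kq_mult_add_left kq_mult_smult_left wt_poly_add[OF KQ_smult[OF KQ_mult[OF bp g]] KQ_mult[OF add(2) g]]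
        wt_poly_add[OF KQ_smult[OF bp] add(2)] wt_poly_smult[OF bp] wt_poly_smult[OF KQ_mult[OF bp g]]
        add.IH distrib_right sum.distrib smult_sum_right)
qed

lemma wt_poly_idem:
  assumes "finite A"
  shows "wt_poly d e (idem A :: _ \<Rightarrow> 'a::field) = (if d = e \<and> d \<in> A then 1 else 0)"
proof -
  have "wt_poly d e (idem A :: _ \<Rightarrow> 'a) =
     (\<Sum>p\<in>(\<lambda>v. (v, [])) ` A. if fst p = d \<and> ptgt p = e then monom (idem A p) (wt (snd p)) else 0)"
    by (rule wt_poly_superset) (use assms in \<open>auto simp: idem_def split: if_splits\<close>)
  also have "\<dots> = (\<Sum>v\<in>A. if v = d then (if d = e then 1 else 0) else 0)"
    by (subst sum.reindex) (auto simp: inj_on_def idem_def intro!: sum.cong sum.neutral)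
  also have "\<dots> = (if d = e \<and> d \<in> A then 1 else 0)" using assms by simp
  finally show ?thesis .
qed

lemma KQ_idem: "finite A \<Longrightarrow> A \<subseteq> edges n D \<Longrightarrow> (idem A :: _ \<Rightarrow> 'a::field) \<in> KQ n D"
  by (auto simp: KQ_def idem_def is_path_def split: if_splits
      intro: finite_subset[of _ "(\<lambda>v. (v, [])) ` A"])

section \<open>The Jacobian ideal and congruence of paths\<close>

lemma Jideal_add: "f \<in> Jideal n D \<Longrightarrow> g \<in> Jideal n D \<Longrightarrow> (\<lambda>p. f p + g p) \<in> Jideal n D"
  unfolding Jideal_def kq_ideal_def kq_add_def by blast

lemma Jideal_smult: "f \<in> Jideal n D \<Longrightarrow> (\<lambda>p. c * f p) \<in> Jideal n D"
  unfolding Jideal_def kq_ideal_def by blast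

lemma Jideal_zero: "(\<lambda>p. 0) \<in> Jideal n D"
  unfolding Jideal_def kq_ideal_def by blast

lemma Jideal_mult_left: "f \<in> Jideal n D \<Longrightarrow> g \<in> KQ n D \<Longrightarrow> kq_mult g f \<in> Jideal n D"
  unfolding Jideal_def kq_ideal_def by blast

lemma Jideal_mult_right: "f \<in> Jideal n D \<Longrightarrow> g \<in> KQ n D \<Longrightarrow> kq_mult f g \<in> Jideal n D"
  unfolding Jideal_def kq_ideal_def by blast

lemma dW_in_Jideal:
  "a \<in> arrows n D \<Longrightarrow> asrc a \<notin> frozen n \<or> atgt a \<notin> frozen n \<Longrightarrow> dW n D a \<in> Jideal n D"
  unfolding Jideal_def kq_ideal_def by blast

text \<open>The type argument fixes the coefficient field, which the two paths do not
  mention.\<close>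

definition path_eq :: "'a::field itself \<Rightarrow> nat \<Rightarrow> edge set \<Rightarrow> edge \<Rightarrow> arrow list \<Rightarrow> arrow list \<Rightarrow> bool" where
  "path_eq _ n D v as bs \<longleftrightarrow> (\<lambda>p. kq_basis (v, as) p - kq_basis (v, bs) p :: 'a) \<in> Jideal n D"

lemma path_eq_refl: "path_eq T n D v as as"
  by (simp add: path_eq_def Jideal_zero)

lemma path_eq_sym:
  fixes T :: "'a::field itself"
  assumes "path_eq T n D v as bs" shows "path_eq T n D v bs as"
  using Jideal_smult[of "\<lambda>p. kq_basis (v, as) p - kq_basis (v, bs) p :: 'a" n D "-1"] assms
  by (simp add: path_eq_def)

lemma path_eq_trans:
  fixes T :: "'a::field itself"
  assumes "path_eq T n D v as bs" "path_eq T n D v bs cs" shows "path_eq T n D v as cs"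
  using Jideal_add[of "\<lambda>p. kq_basis (v, as) p - kq_basis (v, bs) p :: 'a" n D
      "\<lambda>p. kq_basis (v, bs) p - kq_basis (v, cs) p"] assms
  by (simp add: path_eq_def)

lemma path_eq_append_right:
  fixes T :: "'a::field itself"
  assumes "path_eq T n D v as bs" "pend v as = w" "pend v bs = w" "is_path n D (w, cs)"
  shows "path_eq T n D v (as @ cs) (bs @ cs)"
  using Jideal_mult_right[OF assms(1)[unfolded path_eq_def] KQ_basis[OF assms(4)]] assms(2,3)
  by (simp add: path_eq_def kq_mult_diff_left kq_mult_basis)

lemma path_eq_append_left:
  fixes T :: "'a::field itself"
  assumes "path_eq T n D (pend w cs) as bs" "is_path n D (w, cs)"
  shows "path_eq T n D w (cs @ as) (cs @ bs)"
  using Jideal_mult_left[OF assms(1)[unfolded path_eq_def] KQ_basis[OF assms(2)]]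
  by (simp add: path_eq_def kq_mult_diff_right kq_mult_basis)

text \<open>A single rotation brings the arrow to the end of the cycle, where the truncation in
  \<open>cder\<close> removes it.\<close>

lemma cder_unique:
  assumes "a \<notin> set xs" "a \<notin> set ys"
  shows "cder (xs @ a # ys) a = [(atgt a, ys @ xs)]"
proof -
  let ?c = "xs @ a # ys"
  have "[0..<length ?c] = [0..<length xs] @ length xs # [Suc (length xs)..<length ?c]"
    using upt_add_eq_append[of 0 "length xs" "Suc (length ys)"]
    by (simp del: upt_Suc add: upt_conv_Cons)
  moreover have "filter (\<lambda>i. ?c ! i = a) [0..<length xs] = []"
    using assms by (auto simp: filter_empty_conv nth_append)
  moreover have "filter (\<lambda>i. ?c ! i = a) [Suc (length xs)..<length ?c] = []"
    using assms by (auto simp: filter_empty_conv nth_append nth_Cons')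
  ultimately have "filter (\<lambda>i. ?c ! i = a) [0..<length ?c] = [length xs]" by simp
  moreover have "rotate (Suc (length xs)) ?c = ys @ xs @ [a]"
    using rotate_append[of "xs @ [a]" ys] by simp
  ultimately show ?thesis by (simp add: cder_def)
qed

lemma cder_empty: "a \<notin> set c \<Longrightarrow> cder c a = []"
  by (auto simp: cder_def filter_empty_conv)

text \<open>Among paths with the same ends and weight the coefficients of \<open>f\<close> sum to
  zero, so a path of the support is never alone in its class. Subtracting a multiple of the
  difference of two such paths, which lies in the ideal, removes one path from the support and adds
  none.\<close>

lemma in_Jideal_of_wt_poly_zero:
  assumes f: "(f :: path \<Rightarrow> 'a::field) \<in> KQ n D"
    and F: "\<And>p. f p \<noteq> 0 \<Longrightarrow> fst p \<in> F"
    and z: "\<And>d e. wt_poly d e f = 0"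
    and eq: "\<And>p q. is_path n D p \<Longrightarrow> is_path n D q \<Longrightarrow> fst p \<in> F \<Longrightarrow> fst q = fst p \<Longrightarrow> ptgt p = ptgt q \<Longrightarrow>
        wt (snd p) = wt (snd q) \<Longrightarrow> path_eq TYPE('a) n D (fst p) (snd p) (snd q)"
  shows "f \<in> Jideal n D"
  using f F z
proof (induction "card {p. f p \<noteq> 0}" arbitrary: f rule: less_induct)
  case less
  have fin: "finite {p. f p \<noteq> 0}" using less.prems by (simp add: KQ_def)
  show ?case
  proof (cases "f = (\<lambda>p. 0)")
    case True
    then show ?thesis by (simp add: Jideal_zero)
  next
    case False
    then obtain p where p: "f p \<noteq> 0" by (metis ext)
    let ?S = "{q. f q \<noteq> 0 \<and> fst q = fst p \<and> ptgt q = ptgt p \<and> wt (snd q) = wt (snd p)}"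
    have "(\<Sum>q\<in>?S. f q) = 0"
      using coeff_wt_poly[OF fin, of "fst p" "ptgt p" "wt (snd p)"] less.prems(3) by simp
    moreover have "sum f {p} \<noteq> 0" using p by simp
    ultimately have "?S \<noteq> {p}" by metis
    then obtain q where q: "q \<in> ?S" "q \<noteq> p" using p by blast
    let ?b = "\<lambda>r. kq_basis p r - kq_basis q r :: 'a"
    let ?g = "\<lambda>r. f r - f p * ?b r"
    have pp: "is_path n D p" "is_path n D q" using p q less.prems(1) by (auto simp: KQ_def)
    have bK: "?b \<in> KQ n D" by (intro KQ_diff KQ_basis pp)
    have "path_eq TYPE('a) n D (fst p) (snd p) (snd q)"
      using q pp p less.prems(2) by (intro eq) auto
    moreover have "q = (fst p, snd q)" using q by (cases q) auto
    ultimately have bJ: "?b \<in> Jideal n D" by (simp add: path_eq_def)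
    have gK: "?g \<in> KQ n D" by (intro KQ_diff KQ_smult bK less.prems)
    have sub: "{r. ?g r \<noteq> 0} \<subset> {r. f r \<noteq> 0}"
      using p q by (auto simp: kq_basis_def)
    have "?g \<in> Jideal n D"
    proof (rule less.hyps[OF psubset_card_mono[OF fin sub] gK])
      show "fst r \<in> F" if "?g r \<noteq> 0" for r using that sub less.prems(2) by blast
      show "wt_poly d e ?g = 0" for d e
        unfolding wt_poly_diff[OF less.prems(1) KQ_smult[OF bK]] wt_poly_smult[OF bK]
          wt_poly_diff[OF KQ_basis[OF pp(1)] KQ_basis[OF pp(2)]] wt_poly_basis
        using less.prems(3) q by auto
    qed
    from Jideal_add[OF this Jideal_smult[OF bJ, of "f p"]] show ?thesis by simp
  qed
qed

section \<open>Triangulated polygons\<close>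

definition ed :: "nat \<Rightarrow> nat \<Rightarrow> edge" where
  "ed p q = (min p q, max p q)"

text \<open>Stated cyclically so that a triangle can be rotated freely; with ordered vertices most
  arguments would split into three cases.\<close>

definition ccw :: "nat \<Rightarrow> nat \<Rightarrow> nat \<Rightarrow> bool" where
  "ccw p q r \<longleftrightarrow> p < q \<and> q < r \<or> q < r \<and> r < p \<or> r < p \<and> p < q"

lemma ed_commute: "ed p q = ed q p"
  by (simp add: ed_def min.commute max.commute)

lemma ed_eq_iff: "ed a b = ed c d \<longleftrightarrow> a = c \<and> b = d \<or> a = d \<and> b = c"
  by (auto simp: ed_def min_def max_def split: if_splits)

lemma ed_less: "a < b \<Longrightarrow> ed a b = (a, b)" "b < a \<Longrightarrow> ed a b = (b, a)"
  by (simp_all add: ed_def)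

lemma in_ed_iff: "i \<in> {fst (ed a b), snd (ed a b)} \<longleftrightarrow> i = a \<or> i = b"
  by (auto simp: ed_def min_def max_def)

lemma ccw_rotate: "ccw p q r \<Longrightarrow> ccw q r p"
  by (auto simp: ccw_def)

lemma ccw_other: "ccw a b c \<Longrightarrow> ccw b c y \<Longrightarrow> y \<noteq> a \<Longrightarrow> ccw c y a \<or> ccw a y b"
  unfolding ccw_def by linarith

lemma ccw_between: "ccw a b c \<Longrightarrow> ccw b x c \<Longrightarrow> ccw a b x \<and> ccw a x c \<and> ccw c a x"
  unfolding ccw_def by linarith

lemma ccw_linear: "ccw a b c \<Longrightarrow> ccw a b d \<Longrightarrow> c \<noteq> d \<Longrightarrow> ccw a c d \<or> ccw a d c"
  unfolding ccw_def by linarith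

section \<open>Sides, diagonals and crossings\<close>

locale triangulated_polygon =
  fixes n :: nat and D :: "edge set"
  assumes n3: "3 \<le> n" and triangulation: "is_triangulation n D"
begin

definition succ :: "nat \<Rightarrow> nat" where "succ a = (if a = n then 1 else Suc a)"
definition pred :: "nat \<Rightarrow> nat" where "pred a = (if a = 1 then n else a - 1)"
text \<open>Counterclockwise distance between vertices; at equal arguments the value is
  \<open>n\<close> rather than 0.\<close>

definition cdist :: "nat \<Rightarrow> nat \<Rightarrow> nat" where "cdist a b = (if a < b then b - a else n + b - a)"

lemma next_side_ed: "1 \<le> a \<Longrightarrow> a \<le> n \<Longrightarrow> next_side n a = ed a (succ a)"
  using n3 by (auto simp: next_side_def succ_def ed_def)

lemma prev_side_ed: "1 \<le> a \<Longrightarrow> a \<le> n \<Longrightarrow> prev_side n a = ed a (pred a)"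
  using n3 by (auto simp: prev_side_def pred_def ed_def)

lemma edge_range: "(s,t) \<in> edges n D \<Longrightarrow> 1 \<le> s \<and> s < t \<and> t \<le> n"
  using n3 triangulation by (auto simp: edges_def is_side_def is_triangulation_def is_diagonal_def)

lemma ed_range: "ed a b \<in> edges n D \<Longrightarrow> a \<noteq> b \<and> 1 \<le> a \<and> a \<le> n \<and> 1 \<le> b \<and> b \<le> n"
  using edge_range[of "min a b" "max a b"] by (auto simp: ed_def min_def max_def split: if_splits)

lemma finite_edges: "finite (edges n D)"
  by (rule finite_subset[of _ "{1..n} \<times> {1..n}"]) (use edge_range in fastforce, simp)

lemma side_in_edges: "is_side n e \<Longrightarrow> e \<in> edges n D"
  by (simp add: edges_def)

lemma next_side_is_side: "1 \<le> a \<Longrightarrow> a \<le> n \<Longrightarrow> is_side n (next_side n a)"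
  by (auto simp: is_side_def next_side_def)

lemma prev_side_is_side: "1 \<le> a \<Longrightarrow> a \<le> n \<Longrightarrow> is_side n (prev_side n a)"
  by (auto simp: is_side_def prev_side_def)

lemma side_cases:
  assumes "is_side n e"
  obtains a where "1 \<le> a" "a \<le> n" "e = next_side n a"
proof (cases "e = (1, n)")
  case True
  with n3 that[of n] show ?thesis by (simp add: next_side_def)
next
  case False
  with assms that[of "fst e"] show ?thesis by (cases e) (auto simp: is_side_def next_side_def)
qed

lemma not_side_in_D: "e \<in> edges n D \<Longrightarrow> \<not> is_side n e \<Longrightarrow> e \<in> D"
  by (simp add: edges_def)

lemma no_crossing:
  assumes "d \<in> edges n D" "e \<in> edges n D" shows "\<not> crossing d e"
proof -
  have side: "\<not> crossing d e \<and> \<not> crossing e d" if "is_side n d" "e \<in> edges n D" for d e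
    using that edge_range[of "fst e" "snd e"] by (cases d; cases e) (auto simp: crossing_def is_side_def)
  show ?thesis
    using assms side triangulation unfolding edges_def is_triangulation_def by blast
qed

lemma ccw_not_edges:
  assumes "ccw a x b" "ccw a b y" "ed a b \<in> edges n D" "ed x y \<in> edges n D"
  shows False
proof -
  have "crossing (ed a b) (ed x y)"
    using assms(1,2) by (auto simp: ccw_def crossing_def ed_def min_def max_def)
  with no_crossing assms show False by blast
qed

text \<open>This is where maximality of the triangulation enters. The crossing edge is given by its
  ends on the two sides of \<open>ab\<close>.\<close>

lemma crossed_if_not_edge:
  assumes "1 \<le> a" "a \<le> n" "1 \<le> b" "b \<le> n" "a \<noteq> b" "ed a b \<notin> edges n D"
  obtains x y where "ccw a x b" "ccw a b y" "ed x y \<in> edges n D"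
proof -
  have "is_diagonal n (ed a b)"
    using assms by (auto simp: is_diagonal_def edges_def is_side_def ed_def min_def max_def split: if_splits)
  with assms(6) obtain e where e: "e \<in> D" "crossing (ed a b) e"
    using triangulation by (auto simp: is_triangulation_def edges_def)
  obtain u v where uv: "e = (u, v)" "u < v" using e edge_range by (cases e) (force simp: edges_def)
  then have "ed u v = e" "ed v u = e" by (auto simp: ed_less)
  moreover have "ed u v \<in> edges n D" "ed v u \<in> edges n D" using e calculation by (auto simp: edges_def)
  moreover have "ccw a u b \<and> ccw a b v \<or> ccw a v b \<and> ccw a b u"
    using e(2) uv \<open>a \<noteq> b\<close> by (auto simp: crossing_def ccw_def ed_def min_def max_def split: if_splits)
  ultimately show ?thesis using that by blast
qed

section \<open>Triangles\<close>

definition triangle :: "nat \<Rightarrow> nat \<Rightarrow> nat \<Rightarrow> bool" where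
  "triangle a b c \<longleftrightarrow> ccw a b c \<and> ed a b \<in> edges n D \<and> ed b c \<in> edges n D \<and> ed a c \<in> edges n D"

lemma triangle_rotate: "triangle a b c \<Longrightarrow> triangle b c a"
  by (auto simp: triangle_def ccw_rotate ed_commute)

text \<open>If \<open>c\<close> comes before \<open>c'\<close> counterclockwise from
  \<open>b\<close>, the edges \<open>ac\<close> and \<open>bc'\<close> cross.\<close>

lemma triangle_unique:
  assumes "triangle a b c" "triangle a b c'"
  shows "c = c'"
proof (rule ccontr)
  assume "c \<noteq> c'"
  have *: False if "triangle a b c" "triangle a b c'" "ccw a c c'" for c c'
  proof (rule ccw_not_edges[of a b c c'])
    show "ccw a b c" "ed a c \<in> edges n D" using that by (auto simp: triangle_def)
    show "ed b c' \<in> edges n D" using that by (auto simp: triangle_def)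
  qed (fact that)
  have "ccw a c c' \<or> ccw a c' c"
    using assms \<open>c \<noteq> c'\<close> ccw_linear[of a b c c'] by (auto simp: triangle_def)
  with * assms show False by blast
qed

lemma triangle_unique': "triangle a c b \<Longrightarrow> triangle a c' b \<Longrightarrow> c = c'"
  by (meson triangle_rotate triangle_unique)

lemma ccw_pred: "1 \<le> a \<Longrightarrow> a \<le> n \<Longrightarrow> 1 \<le> b \<Longrightarrow> b \<le> n \<Longrightarrow> a \<noteq> b \<Longrightarrow> b \<noteq> pred a \<Longrightarrow> ccw a b (pred a)"
  by (auto simp: ccw_def pred_def)

lemma not_ccw_pred: "1 \<le> c \<Longrightarrow> c \<le> n \<Longrightarrow> \<not> ccw a (pred a) c"
  by (auto simp: ccw_def pred_def)

lemma ccw_succ: "1 \<le> a \<Longrightarrow> a \<le> n \<Longrightarrow> 1 \<le> b \<Longrightarrow> b \<le> n \<Longrightarrow> a \<noteq> b \<Longrightarrow> b \<noteq> succ a \<Longrightarrow> ccw a (succ a) b"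
  by (auto simp: ccw_def succ_def)

lemma not_ccw_succ: "1 \<le> c \<Longrightarrow> c \<le> n \<Longrightarrow> \<not> ccw a c (succ a)"
  by (auto simp: ccw_def succ_def)

lemma pred_eq_iff: "1 \<le> a \<Longrightarrow> a \<le> n \<Longrightarrow> 1 \<le> b \<Longrightarrow> b \<le> n \<Longrightarrow> b = pred a \<longleftrightarrow> a = succ b"
  using n3 by (auto simp: pred_def succ_def)

lemma cdist_mono: "ccw a b c \<Longrightarrow> a \<le> n \<Longrightarrow> b \<le> n \<Longrightarrow> 1 \<le> c \<Longrightarrow> cdist a b < cdist a c"
  by (auto simp: ccw_def cdist_def)

text \<open>Take the edge at \<open>a\<close> that follows \<open>ab\<close> counterclockwise. If
  its end \<open>c\<close> were not joined to \<open>b\<close>, an edge crossing \<open>bc\<close>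
  could avoid crossing \<open>ab\<close> and \<open>ac\<close> only by ending at \<open>a\<close>,
  and would then lie between these two.\<close>

lemma triangle_exists:
  assumes e: "ed a b \<in> edges n D" and b: "b \<noteq> pred a"
  obtains c where "triangle a b c"
proof -
  note ab = ed_range[OF e]
  let ?P = "\<lambda>c. ccw a b c \<and> ed a c \<in> edges n D"
  \<comment> \<open>The previous side at \<open>a\<close> guarantees that there is a
    candidate.\<close>
  have "?P (pred a)"
    using ab b ccw_pred[of a b] prev_side_ed[of a] side_in_edges[OF prev_side_is_side[of a]] by simp
  then obtain c where c: "?P c" and min: "\<And>x. ?P x \<Longrightarrow> cdist a c \<le> cdist a x"
    using ex_has_least_nat[of ?P "pred a" "cdist a"] by blast
  have ac: "1 \<le> c" "c \<le> n" using c ed_range[of a c] by auto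
  have "ed b c \<in> edges n D"
  proof (rule ccontr)
    assume bc: "ed b c \<notin> edges n D"
    have "b \<noteq> c" using c by (auto simp: ccw_def)
    from crossed_if_not_edge[OF _ _ ac this bc] ab
    obtain x y where xy: "ccw b x c" "ccw b c y" "ed x y \<in> edges n D" by blast
    note r = ed_range[OF xy(3)]
    have "y = a"
    proof (rule ccontr)
      assume "y \<noteq> a"
      then have "ccw c y a \<and> ccw c a x \<or> ccw a y b \<and> ccw a b x"
        using ccw_other[OF _ xy(2)] ccw_between[OF _ xy(1)] c by blast
      then show False
        using ccw_not_edges[of c y a x] ccw_not_edges[of a y b x] xy(3) c e
        unfolding ed_commute[of y x] ed_commute[of c a] by blast
    qed
    then have "?P x" using ccw_between[OF _ xy(1)] xy(3) c ed_commute[of x a] by simp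
    moreover have "ccw a x c" using ccw_between[OF _ xy(1)] c by blast
    then have "cdist a x < cdist a c" by (rule cdist_mono) (use r ab ac in auto)
    ultimately show False using min[of x] by simp
  qed
  with c e that show ?thesis by (auto simp: triangle_def)
qed

lemma triangle_exists':
  assumes e: "ed a b \<in> edges n D" and b: "b \<noteq> succ a"
  obtains d where "triangle a d b"
proof -
  have "a \<noteq> pred b" using b ed_range[OF e] pred_eq_iff[of b a] by auto
  then obtain d where "triangle b a d" using triangle_exists[of b a] e by (metis ed_commute)
  then show ?thesis using that triangle_rotate by blast
qed

lemma triangle_range:
  assumes "triangle a b c"
  shows "1 \<le> a" "a \<le> n" "1 \<le> b" "b \<le> n" "1 \<le> c" "c \<le> n" "a \<noteq> b" "b \<noteq> c" "a \<noteq> c"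
  using assms ed_range[of a b] ed_range[of b c] ed_range[of a c] by (auto simp: triangle_def)

section \<open>Arrows and their weights\<close>

lemma internal_arrows_eq:
  "internal_arrows n D = {IArr (ed a b) (ed a c) | a b c. triangle a b c}"
proof (intro set_eqI iffI)
  fix x assume "x \<in> internal_arrows n D"
  then obtain u v w where t: "is_triangle n D u v w"
    and x: "x = IArr (u,v) (u,w) \<or> x = IArr (u,w) (v,w) \<or> x = IArr (v,w) (u,v)"
    unfolding internal_arrows_def by blast
  have uvw: "triangle u v w" using t by (auto simp: is_triangle_def triangle_def ccw_def ed_less)
  have lt: "u < v" "v < w" "u < w" using t by (auto simp: is_triangle_def)
  have ed: "ed u v = (u,v)" "ed v w = (v,w)" "ed u w = (u,w)" "ed v u = (u,v)" "ed w v = (v,w)" "ed w u = (u,w)"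
    using lt by (simp_all add: ed_less)
  have "x = IArr (ed u v) (ed u w) \<or> x = IArr (ed w u) (ed w v) \<or> x = IArr (ed v w) (ed v u)"
    using x unfolding ed .
  then show "x \<in> {IArr (ed a b) (ed a c) | a b c. triangle a b c}"
    using uvw triangle_rotate[OF uvw] triangle_rotate[OF triangle_rotate[OF uvw]] by blast
next
  fix x assume "x \<in> {IArr (ed a b) (ed a c) | a b c. triangle a b c}"
  then obtain a b c where x: "x = IArr (ed a b) (ed a c)" and t: "triangle a b c" by blast
  from t have "is_triangle n D a b c \<or> is_triangle n D b c a \<or> is_triangle n D c a b"
    by (auto simp: triangle_def ccw_def is_triangle_def ed_def min_def max_def split: if_splits)
  then show "x \<in> internal_arrows n D"
    unfolding internal_arrows_def x
    by (elim disjE) (auto simp: ed_less is_triangle_def)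
qed

lemma triangle_arrow:
  assumes "triangle a b c"
  shows "IArr (ed a b) (ed a c) \<in> arrows n D"
  using assms unfolding arrows_def internal_arrows_eq by blast

lemma incident_diag_range: "incident_diag D a \<Longrightarrow> 1 \<le> a \<and> a \<le> n"
  using edge_range by (force simp: incident_diag_def edges_def)

lemma arrows_cases:
  assumes "x \<in> arrows n D"
  obtains (internal) a b c where "triangle a b c" "x = IArr (ed a b) (ed a c)"
  | (external) a where "incident_diag D a" "1 \<le> a" "a \<le> n" "x = EArr (prev_side n a) (next_side n a)"
  using assms unfolding arrows_def external_arrows_def internal_arrows_eq by blast

lemma arrow_in_edges: "x \<in> arrows n D \<Longrightarrow> asrc x \<in> edges n D \<and> atgt x \<in> edges n D"
  by (erule arrows_cases)
    (auto simp: triangle_def intro!: side_in_edges prev_side_is_side next_side_is_side)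

lemma iarr_eq_iff:
  assumes "triangle a b c" "triangle a' b' c'"
  shows "IArr (ed a b) (ed a c) = IArr (ed a' b') (ed a' c') \<longleftrightarrow> a = a' \<and> b = b' \<and> c = c'"
  using triangle_range[OF assms(1)] triangle_range[OF assms(2)] by (auto simp: ed_eq_iff)

text \<open>Stated as an increment so that the weights along a fan telescope.\<close>
lemma arrow_wt_internal:
  "triangle a b c \<Longrightarrow> arrow_wt (IArr (ed a b) (ed a c)) + of_bool (b < a) = of_bool (c < a)"
  unfolding triangle_def ccw_def by (elim conjE disjE) (simp_all add: arrow_wt_def ed_less)

lemma arrow_wt_triangle:
  "triangle a b c \<Longrightarrow> arrow_wt (IArr (ed a b) (ed a c)) + arrow_wt (IArr (ed c a) (ed c b)) +
     arrow_wt (IArr (ed b c) (ed b a)) = 1"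
  unfolding triangle_def ccw_def by (elim conjE disjE) (simp_all add: arrow_wt_def ed_less)

lemma arrow_wt_external:
  "1 \<le> a \<Longrightarrow> a \<le> n \<Longrightarrow> arrow_wt (EArr (prev_side n a) (next_side n a)) = of_bool (a = 1 \<or> a = n)"
  using n3 by (auto simp: arrow_wt_def prev_side_def next_side_def of_bool_def)

section \<open>Turning around a vertex inside the polygon\<close>

definition fan :: "nat \<Rightarrow> arrow list \<Rightarrow> bool" where
  "fan a as \<longleftrightarrow> (\<forall>x\<in>set as. \<exists>b c. triangle a b c \<and> x = IArr (ed a b) (ed a c))"

lemma fan_simps [simp]: "fan a []"
  "fan a (x # as) \<longleftrightarrow> (\<exists>b c. triangle a b c \<and> x = IArr (ed a b) (ed a c)) \<and> fan a as"
  "fan a (as @ bs) \<longleftrightarrow> fan a as \<and> fan a bs"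
  by (auto simp: fan_def)

lemma fan_iff:
  "fan i as \<longleftrightarrow> (\<forall>a\<in>set as. a \<in> internal_arrows n D \<and> i \<in> {fst (asrc a), snd (asrc a)} \<and>
      i \<in> {fst (atgt a), snd (atgt a)})"
proof -
  have "(\<exists>b c. triangle i b c \<and> x = IArr (ed i b) (ed i c)) \<longleftrightarrow>
      x \<in> internal_arrows n D \<and> i \<in> {fst (asrc x), snd (asrc x)} \<and> i \<in> {fst (atgt x), snd (atgt x)}" for x
  proof
    assume "\<exists>b c. triangle i b c \<and> x = IArr (ed i b) (ed i c)"
    then obtain b c where t: "triangle i b c" and x: "x = IArr (ed i b) (ed i c)" by blast
    have "x \<in> internal_arrows n D" unfolding internal_arrows_eq using t x by blast
    then show "x \<in> internal_arrows n D \<and> i \<in> {fst (asrc x), snd (asrc x)} \<and> i \<in> {fst (atgt x), snd (atgt x)}"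
      unfolding x asrc.simps atgt.simps in_ed_iff by simp
  next
    assume r: "x \<in> internal_arrows n D \<and> i \<in> {fst (asrc x), snd (asrc x)} \<and> i \<in> {fst (atgt x), snd (atgt x)}"
    then obtain a b c where x: "triangle a b c" "x = IArr (ed a b) (ed a c)"
      unfolding internal_arrows_eq by blast
    have "i = a \<or> i = b" "i = a \<or> i = c" using r unfolding x(2) asrc.simps atgt.simps in_ed_iff by simp_all
    then have "i = a" using triangle_range(8)[OF x(1)] by blast
    with x show "\<exists>b c. triangle i b c \<and> x = IArr (ed i b) (ed i c)" by blast
  qed
  then show ?thesis by (simp add: fan_def)
qed

lemma fan_arrows: "fan a as \<Longrightarrow> set as \<subseteq> arrows n D"
  using triangle_arrow by (auto simp: fan_def)

text \<open>Passing through the triangles at \<open>a\<close> counterclockwise increases the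
  distance of the other endpoint from \<open>a\<close>, which is at most \<open>n\<close>; the
  process stops only at the previous side.\<close>

lemma fan_to_prev_side:
  assumes "ed a b \<in> edges n D"
  obtains as where "fan a as" "chain (ed a b) as" "pend (ed a b) as = prev_side n a"
proof -
  have "\<exists>as. fan a as \<and> chain (ed a b) as \<and> pend (ed a b) as = prev_side n a"
    using assms
  proof (induction "n - cdist a b" arbitrary: b rule: less_induct)
    case less
    note r = ed_range[OF less.prems]
    show ?case
    proof (cases "b = pred a")
      case True
      then show ?thesis using r by (intro exI[of _ "[]"]) (simp add: prev_side_ed)
    next
      case False
      then obtain c where c: "triangle a b c" using triangle_exists less.prems by blast
      note rc = triangle_range[OF c]
      have "cdist a b < cdist a c" using c rc by (intro cdist_mono) (auto simp: triangle_def)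
      moreover have "cdist a c \<le> n" using rc by (auto simp: cdist_def)
      ultimately have "n - cdist a c < n - cdist a b" by linarith
      then obtain as where "fan a as" "chain (ed a c) as" "pend (ed a c) as = prev_side n a"
        using less.hyps[of c] c by (auto simp: triangle_def)
      with c show ?thesis by (intro exI[of _ "IArr (ed a b) (ed a c) # as"]) auto
    qed
  qed
  with that show ?thesis by blast
qed

lemma fan_from_next_side:
  assumes "ed a b \<in> edges n D"
  obtains as where "fan a as" "chain (next_side n a) as" "pend (next_side n a) as = ed a b"
proof -
  have "\<exists>as. fan a as \<and> chain (next_side n a) as \<and> pend (next_side n a) as = ed a b"
    using assms
  proof (induction "cdist a b" arbitrary: b rule: less_induct)
    case less
    note r = ed_range[OF less.prems]
    show ?case
    proof (cases "b = succ a")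
      case True
      then show ?thesis using r by (intro exI[of _ "[]"]) (simp add: next_side_ed)
    next
      case False
      then obtain c where c: "triangle a c b" using triangle_exists' less.prems by blast
      note rc = triangle_range[OF c]
      have "cdist a c < cdist a b" using c rc by (intro cdist_mono) (auto simp: triangle_def)
      then obtain as where "fan a as" "chain (next_side n a) as" "pend (next_side n a) as = ed a c"
        using less.hyps[of c] c by (auto simp: triangle_def)
      with c show ?thesis by (intro exI[of _ "as @ [IArr (ed a c) (ed a b)]"]) auto
    qed
  qed
  with that show ?thesis by blast
qed

lemma fan_not_from_prev_side:
  assumes "triangle a b c" shows "ed a b \<noteq> prev_side n a"
  using triangle_range[OF assms] not_ccw_pred[of c a] assms
  by (auto simp: prev_side_ed ed_eq_iff triangle_def)

text \<open>The triangle that follows a given edge at \<open>a\<close> is unique and none follows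
  the previous side, so a fan ending there is forced step by step.\<close>

lemma fan_unique:
  "fan a as \<Longrightarrow> fan a bs \<Longrightarrow> chain v as \<Longrightarrow> chain v bs \<Longrightarrow> pend v as = prev_side n a \<Longrightarrow>
    pend v bs = prev_side n a \<Longrightarrow> as = bs"
proof (induction as arbitrary: v bs)
  case Nil
  then show ?case using fan_not_from_prev_side by (cases bs) auto
next
  case (Cons x as)
  then obtain y cs where bs: "bs = y # cs"
    using fan_not_from_prev_side by (cases bs) auto
  obtain b c where x: "triangle a b c" "x = IArr (ed a b) (ed a c)" using Cons.prems by auto
  obtain b' c' where y: "triangle a b' c'" "y = IArr (ed a b') (ed a c')" using Cons.prems bs by auto
  have "ed a b = ed a b'" using Cons.prems x y bs by simp
  then have "b = b'" by (auto simp: ed_eq_iff)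
  then have "c = c'" using triangle_unique x(1) y(1) by blast
  then have "x = y" using x y \<open>b = b'\<close> by simp
  moreover have "as = cs" by (rule Cons.IH[of cs "atgt x"]) (use Cons.prems bs \<open>x = y\<close> in auto)
  ultimately show ?case using bs by simp
qed

text \<open>The distance from \<open>a\<close> only grows along a fan. Hence no arrow recurs, and
  the derivative of a big cycle at an internal arrow on it has a single term.\<close>

lemma fan_cdist:
  "fan a as \<Longrightarrow> chain (ed a b) as \<Longrightarrow> IArr (ed a b') (ed a c') \<in> set as \<Longrightarrow> triangle a b' c' \<Longrightarrow>
    cdist a b \<le> cdist a b'"
proof (induction as arbitrary: b)
  case (Cons x as)
  obtain d c where x: "triangle a d c" "x = IArr (ed a d) (ed a c)" using Cons.prems by auto
  have d: "d = b" using Cons.prems x by (auto simp: ed_eq_iff)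
  show ?case
  proof (cases "x = IArr (ed a b') (ed a c')")
    case True
    then show ?thesis using x d Cons.prems(4) iarr_eq_iff by auto
  next
    case False
    have "cdist a b < cdist a c" using x(1) d triangle_range[OF x(1)]
      by (intro cdist_mono) (auto simp: triangle_def)
    then show ?thesis using Cons x False by force
  qed
qed simp

lemma fan_distinct: "fan a as \<Longrightarrow> chain (ed a b) as \<Longrightarrow> distinct as"
proof (induction as arbitrary: b)
  case (Cons x as)
  obtain d c where x: "triangle a d c" "x = IArr (ed a d) (ed a c)" using Cons.prems by auto
  have "cdist a d < cdist a c" using x(1) triangle_range[OF x(1)]
    by (intro cdist_mono) (auto simp: triangle_def)
  then have "x \<notin> set as" using fan_cdist[of a as c d c] Cons.prems x by fastforce
  moreover have "distinct as" using Cons x by (intro Cons.IH[of c]) auto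
  ultimately show ?case by simp
qed simp

text \<open>The increments of \<open>arrow_wt_internal\<close> telescope: a fan climbs a level when
  the other endpoint passes from above \<open>a\<close> to below \<open>a\<close>.\<close>

lemma fan_wt:
  "fan a as \<Longrightarrow> chain (ed a b) as \<Longrightarrow> pend (ed a b) as = ed a c \<Longrightarrow>
    wt as + of_bool (b < a) = of_bool (c < a)"
proof (induction as arbitrary: b)
  case Nil
  then show ?case by (auto simp: ed_eq_iff)
next
  case (Cons x as)
  obtain d c' where x: "triangle a d c'" "x = IArr (ed a d) (ed a c')" using Cons.prems by auto
  have d: "d = b" using Cons.prems x by (auto simp: ed_eq_iff)
  have "wt as + of_bool (c' < a) = of_bool (c < a)" using Cons.prems x by (intro Cons.IH) auto
  with arrow_wt_internal[OF x(1)] x d show ?case by simp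
qed

section \<open>Big cycles and finiteness\<close>

lemma big_cycles_eq:
  "big_cycles n D = {EArr (prev_side n i) (next_side n i) # as | i as.
      incident_diag D i \<and> fan i as \<and> chain (next_side n i) as \<and> pend (next_side n i) as = prev_side n i}"
proof -
  have "as \<noteq> []" if "incident_diag D i" "pend (next_side n i) as = prev_side n i" for i as
    using that incident_diag_range[of i] n3 by (auto simp: next_side_def prev_side_def split: if_splits)
  then have "(1 \<le> i \<and> i \<le> n \<and> incident_diag D i \<and> as \<noteq> [] \<and> fan i as \<and>
      chain (next_side n i) as \<and> pend (next_side n i) as = prev_side n i) \<longleftrightarrow>
      (incident_diag D i \<and> fan i as \<and> chain (next_side n i) as \<and> pend (next_side n i) as = prev_side n i)"
    for i as using incident_diag_range[of i] by blast
  then show ?thesis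
    unfolding big_cycles_def fan_iff[symmetric] by simp
qed

lemma next_side_inj: "1 \<le> a \<Longrightarrow> a \<le> n \<Longrightarrow> 1 \<le> b \<Longrightarrow> b \<le> n \<Longrightarrow> next_side n a = next_side n b \<Longrightarrow> a = b"
  using n3 by (auto simp: next_side_def split: if_splits)

lemma finite_arrows: "finite (arrows n D)"
proof (rule finite_subset)
  show "arrows n D \<subseteq> (\<lambda>(e, f). IArr e f) ` (edges n D \<times> edges n D) \<union> (\<lambda>(e, f). EArr e f) ` (edges n D \<times> edges n D)"
  proof
    fix x assume x: "x \<in> arrows n D"
    show "x \<in> (\<lambda>(e, f). IArr e f) ` (edges n D \<times> edges n D) \<union> (\<lambda>(e, f). EArr e f) ` (edges n D \<times> edges n D)"
      using arrow_in_edges[OF x] by (cases x) (auto simp: image_iff)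
  qed
qed (simp add: finite_edges)

text \<open>The external arrow comes first and determines the vertex; the rest is the unique fan
  between the two sides there. Finiteness matters because \<open>dW\<close> sums over all cycles,
  and a sum over an infinite set would be 0.\<close>

lemma big_cycle_hd_inj: "inj_on hd (big_cycles n D)"
proof (rule inj_onI)
  fix x y assume x: "x \<in> big_cycles n D" and y: "y \<in> big_cycles n D" and hd: "hd x = hd y"
  obtain i as where i: "x = EArr (prev_side n i) (next_side n i) # as" "incident_diag D i" "fan i as"
    "chain (next_side n i) as" "pend (next_side n i) as = prev_side n i"
    using x unfolding big_cycles_eq by blast
  obtain j bs where j: "y = EArr (prev_side n j) (next_side n j) # bs" "incident_diag D j" "fan j bs"
    "chain (next_side n j) bs" "pend (next_side n j) bs = prev_side n j"
    using y unfolding big_cycles_eq by blast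
  have "next_side n i = next_side n j" using hd i(1) j(1) by simp
  then have "i = j" using next_side_inj incident_diag_range i(2) j(2) by blast
  moreover have "as = bs" using fan_unique i j unfolding \<open>i = j\<close> by blast
  ultimately show "x = y" using i(1) j(1) by simp
qed

lemma finite_big_cycles: "finite (big_cycles n D)"
proof (rule finite_imageD[OF _ big_cycle_hd_inj])
  show "finite (hd ` big_cycles n D)"
  proof (rule finite_subset[OF _ finite_arrows])
    show "hd ` big_cycles n D \<subseteq> arrows n D"
      unfolding big_cycles_eq arrows_def external_arrows_def using incident_diag_range by auto
  qed
qed

lemma finite_tri_cycles: "finite (tri_cycles n D)"
proof (rule finite_subset)
  show "tri_cycles n D \<subseteq> {cs. set cs \<subseteq> arrows n D \<and> length cs = 3}"
    unfolding tri_cycles_def arrows_def internal_arrows_def by fastforce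
qed (use finite_lists_length_eq[OF finite_arrows] in simp)

end

section \<open>The relations of the potential\<close>

text \<open>Meant for an internal arrow, which lies on one cyclic triangle and, at a vertex with a
  diagonal, on one big cycle: each sum in \<open>dW\<close> then collapses to one cycle.\<close>

lemma sum_count_cder:
  assumes "finite S" "T \<in> S" "cder T x = [q]" "\<And>T'. T' \<in> S \<Longrightarrow> x \<in> set T' \<Longrightarrow> T' = T"
  shows "(\<Sum>c\<in>S. count_list (cder c x) p) = (if p = q then 1 else 0)"
proof -
  have "(\<Sum>c\<in>S. count_list (cder c x) p) = (\<Sum>c\<in>S. if c = T then (if p = q then 1 else 0) else 0)"
  proof (rule sum.cong)
    fix c assume "c \<in> S"
    show "count_list (cder c x) p = (if c = T then (if p = q then 1 else 0) else 0)"
    proof (cases "c = T")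
      case False
      then have "x \<notin> set c" using assms(4) \<open>c \<in> S\<close> by blast
      with False show ?thesis by (simp add: cder_empty)
    qed (simp add: assms(3))
  qed simp
  with assms(1,2) show ?thesis by simp
qed

context triangulated_polygon
begin

abbreviation iarr :: "nat \<Rightarrow> nat \<Rightarrow> nat \<Rightarrow> arrow" where
  "iarr a b c \<equiv> IArr (ed a b) (ed a c)"

abbreviation earr :: "nat \<Rightarrow> arrow" where
  "earr a \<equiv> EArr (prev_side n a) (next_side n a)"

lemma tri_cycles_eq:
  "tri_cycles n D = {[iarr u v w, iarr w u v, iarr v w u] | u v w. triangle u v w \<and> u < v \<and> v < w}"
proof -
  have "is_triangle n D u v w \<longleftrightarrow> triangle u v w \<and> u < v \<and> v < w" for u v w
    by (auto simp: is_triangle_def triangle_def ccw_def ed_less)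
  moreover have "[iarr u v w, iarr w u v, iarr v w u] = [IArr (u,v) (u,w), IArr (u,w) (v,w), IArr (v,w) (u,v)]"
    if "u < v" "v < w" for u v w using that by (simp add: ed_less)
  ultimately show ?thesis unfolding tri_cycles_def by (intro Collect_cong) metis
qed

text \<open>\<open>tri_cycles\<close> lists each triangle once, starting from its smallest vertex,
  so the arrow may stand in any of three positions; the derivative is the same in all of
  them.\<close>

lemma tri_cycle_through:
  assumes t: "triangle a b c"
  obtains T where "T \<in> tri_cycles n D" "cder T (iarr a b c) = [(ed a c, [iarr c a b, iarr b c a])]"
    "\<And>T'. T' \<in> tri_cycles n D \<Longrightarrow> iarr a b c \<in> set T' \<Longrightarrow> T' = T"
proof -
  note t2 = triangle_rotate[OF t] and t3 = triangle_rotate[OF triangle_rotate[OF t]]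
  note r = triangle_range[OF t]
  have ne: "iarr a b c \<noteq> iarr b c a" "iarr a b c \<noteq> iarr c a b"
    using r by (auto simp: ed_eq_iff)
  have other: "(u, v, w) = (a, b, c) \<or> (u, v, w) = (b, c, a) \<or> (u, v, w) = (c, a, b)"
    if "triangle u v w" "iarr a b c \<in> set [iarr u v w, iarr w u v, iarr v w u]" for u v w
    using that(2) iarr_eq_iff[OF t that(1)] iarr_eq_iff[OF t triangle_rotate[OF that(1)]]
      iarr_eq_iff[OF t triangle_rotate[OF triangle_rotate[OF that(1)]]] by auto
  have uniq: "T' = [iarr u v w, iarr w u v, iarr v w u]"
    if uvw: "u < v" "v < w" "(u, v, w) = (a, b, c) \<or> (u, v, w) = (b, c, a) \<or> (u, v, w) = (c, a, b)"
      and T': "T' \<in> tri_cycles n D" "iarr a b c \<in> set T'" for u v w T'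
  proof -
    from T' obtain u' v' w' where *: "T' = [iarr u' v' w', iarr w' u' v', iarr v' w' u']"
      "triangle u' v' w'" "u' < v'" "v' < w'" unfolding tri_cycles_eq by blast
    with other[of u' v' w'] T' uvw have "u' = u \<and> v' = v \<and> w' = w" by auto
    with * show ?thesis by simp
  qed
  from t consider "a < b" "b < c" | "b < c" "c < a" | "c < a" "a < b"
    unfolding triangle_def ccw_def by blast
  then show ?thesis
  proof cases
    case 1
    show ?thesis
    proof (rule that)
      show "[iarr a b c, iarr c a b, iarr b c a] \<in> tri_cycles n D" using 1 t unfolding tri_cycles_eq by blast
      show "cder [iarr a b c, iarr c a b, iarr b c a] (iarr a b c) = [(ed a c, [iarr c a b, iarr b c a])]"
        using cder_unique[of "iarr a b c" "[]" "[iarr c a b, iarr b c a]"] ne by simp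
    qed (use uniq[of a b c] 1 in blast)
  next
    case 2
    show ?thesis
    proof (rule that)
      show "[iarr b c a, iarr a b c, iarr c a b] \<in> tri_cycles n D" using 2 t2 unfolding tri_cycles_eq by blast
      show "cder [iarr b c a, iarr a b c, iarr c a b] (iarr a b c) = [(ed a c, [iarr c a b, iarr b c a])]"
        using cder_unique[of "iarr a b c" "[iarr b c a]" "[iarr c a b]"] ne by simp
    qed (use uniq[of b c a] 2 in blast)
  next
    case 3
    show ?thesis
    proof (rule that)
      show "[iarr c a b, iarr b c a, iarr a b c] \<in> tri_cycles n D" using 3 t3 unfolding tri_cycles_eq by blast
      show "cder [iarr c a b, iarr b c a, iarr a b c] (iarr a b c) = [(ed a c, [iarr c a b, iarr b c a])]"
        using cder_unique[of "iarr a b c" "[iarr c a b, iarr b c a]" "[]"] ne by simp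
    qed (use uniq[of c a b] 3 in blast)
  qed
qed

text \<open>One fan leads from the next side at \<open>a\<close> to \<open>ab\<close>, another from
  \<open>ac\<close> to the previous side. The arrow determines the vertex about which it turns, and
  uniqueness of fans then leaves no other big cycle.\<close>

lemma big_cycle_through:
  assumes t: "triangle a b c" and inc: "incident_diag D a"
  obtains as bs where "fan a (as @ iarr a b c # bs)" "chain (next_side n a) (as @ iarr a b c # bs)"
    "pend (next_side n a) as = ed a b" "pend (ed a c) bs = prev_side n a"
    "earr a # as @ iarr a b c # bs \<in> big_cycles n D"
    "cder (earr a # as @ iarr a b c # bs) (iarr a b c) = [(ed a c, bs @ earr a # as)]"
    "\<And>T'. T' \<in> big_cycles n D \<Longrightarrow> iarr a b c \<in> set T' \<Longrightarrow> T' = earr a # as @ iarr a b c # bs"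
proof -
  have E: "ed a b \<in> edges n D" "ed a c \<in> edges n D" using t by (auto simp: triangle_def)
  obtain as where as: "fan a as" "chain (next_side n a) as" "pend (next_side n a) as = ed a b"
    using fan_from_next_side[OF E(1)] .
  obtain bs where bs: "fan a bs" "chain (ed a c) bs" "pend (ed a c) bs = prev_side n a"
    using fan_to_prev_side[OF E(2)] .
  let ?L = "as @ iarr a b c # bs"
  note a = incident_diag_range[OF inc]
  have fan: "fan a ?L" "chain (next_side n a) ?L" "pend (next_side n a) ?L = prev_side n a"
    using as bs t by auto
  have "distinct ?L" using fan_distinct[of a ?L "succ a"] fan(1,2) a by (simp add: next_side_ed)
  then have nin: "iarr a b c \<notin> set (earr a # as)" "iarr a b c \<notin> set bs" by auto
  have cder: "cder (earr a # ?L) (iarr a b c) = [(ed a c, bs @ earr a # as)]"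
    using cder_unique[OF nin] by simp
  have big: "earr a # ?L \<in> big_cycles n D"
    unfolding big_cycles_eq using inc fan by blast
  have uniq: "T' = earr a # ?L" if T': "T' \<in> big_cycles n D" "iarr a b c \<in> set T'" for T'
  proof -
    obtain i cs where i: "T' = earr i # cs" "fan i cs" "chain (next_side n i) cs"
      "pend (next_side n i) cs = prev_side n i" using T'(1) unfolding big_cycles_eq by blast
    have "iarr a b c \<in> set cs" using T'(2) i(1) by simp
    then obtain b' c' where "triangle i b' c'" "iarr a b c = iarr i b' c'" using i(2) unfolding fan_def by blast
    then have "i = a" using iarr_eq_iff[OF t] by blast
    with fan_unique[OF i(2)] fan i show ?thesis by blast
  qed
  show ?thesis using that[OF fan(1,2) as(3) bs(3) big cder uniq] .
qed

lemma big_path_props: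
  assumes t: "triangle a b c" and inc: "incident_diag D a"
    and fan: "fan a (as @ iarr a b c # bs)" "chain (next_side n a) (as @ iarr a b c # bs)"
    and pend: "pend (next_side n a) as = ed a b" "pend (ed a c) bs = prev_side n a"
  shows "is_path n D (ed a c, bs @ earr a # as)" "pend (ed a c) (bs @ earr a # as) = ed a b"
    "wt (bs @ earr a # as) + arrow_wt (iarr a b c) = 1"
proof -
  note a = incident_diag_range[OF inc]
  have "earr a \<in> arrows n D" using inc a unfolding arrows_def external_arrows_def by blast
  moreover have "set as \<subseteq> arrows n D" "set bs \<subseteq> arrows n D"
    using fan_arrows[of a as] fan_arrows[of a bs] fan by auto
  ultimately show "is_path n D (ed a c, bs @ earr a # as)"
    using fan pend t by (auto simp: is_path_def triangle_def)
  show "pend (ed a c) (bs @ earr a # as) = ed a b" using pend by simp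
  \<comment> \<open>The whole big cycle has weight 1: at the vertices \<open>1\<close> and
    \<open>n\<close> the external arrow climbs a level, at all others the fan does.\<close>
  have "wt (as @ iarr a b c # bs) + of_bool (succ a < a) = of_bool (pred a < a)"
    by (rule fan_wt[OF fan(1)]) (use fan pend a in \<open>auto simp: next_side_ed prev_side_ed\<close>)
  moreover have "arrow_wt (earr a) = of_bool (a = 1 \<or> a = n)" using arrow_wt_external a by simp
  ultimately show "wt (bs @ earr a # as) + arrow_wt (iarr a b c) = 1"
    using a n3 by (auto simp: succ_def pred_def split: if_splits)
qed

lemma dW_eq:
  assumes t: "triangle a b c" and inc: "incident_diag D a"
    and "earr a # as @ iarr a b c # bs \<in> big_cycles n D"
    "cder (earr a # as @ iarr a b c # bs) (iarr a b c) = [(ed a c, bs @ earr a # as)]"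
    "\<And>T'. T' \<in> big_cycles n D \<Longrightarrow> iarr a b c \<in> set T' \<Longrightarrow> T' = earr a # as @ iarr a b c # bs"
  shows "(dW n D (iarr a b c) :: path \<Rightarrow> 'a::field) =
    (\<lambda>p. kq_basis (ed a c, [iarr c a b, iarr b c a]) p - kq_basis (ed a c, bs @ earr a # as) p)"
proof
  fix p
  obtain T where T: "T \<in> tri_cycles n D" "cder T (iarr a b c) = [(ed a c, [iarr c a b, iarr b c a])]"
    "\<And>T'. T' \<in> tri_cycles n D \<Longrightarrow> iarr a b c \<in> set T' \<Longrightarrow> T' = T" using tri_cycle_through[OF t] by blast
  have 1: "(\<Sum>c'\<in>tri_cycles n D. count_list (cder c' (iarr a b c)) p) =
      (if p = (ed a c, [iarr c a b, iarr b c a]) then 1 else 0)"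
    by (rule sum_count_cder[OF finite_tri_cycles T])
  have 2: "(\<Sum>c'\<in>big_cycles n D. count_list (cder c' (iarr a b c)) p) =
      (if p = (ed a c, bs @ earr a # as) then 1 else 0)"
    by (rule sum_count_cder[OF finite_big_cycles assms(3-5)])
  show "dW n D (iarr a b c) p = (kq_basis (ed a c, [iarr c a b, iarr b c a]) p - kq_basis (ed a c, bs @ earr a # as) p :: 'a)"
    unfolding dW_def 1 2 kq_basis_def if_distrib[of of_nat] of_nat_0 of_nat_1 by (rule refl)
qed

lemma triangle_path_props:
  assumes t: "triangle a b c"
  shows "is_path n D (ed a c, [iarr c a b, iarr b c a])" "pend (ed a c) [iarr c a b, iarr b c a] = ed a b"
    "wt [iarr c a b, iarr b c a] + arrow_wt (iarr a b c) = 1"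
proof -
  have "iarr c a b \<in> arrows n D" "iarr b c a \<in> arrows n D"
    using triangle_arrow triangle_rotate[OF t] triangle_rotate[OF triangle_rotate[OF t]] by blast+
  moreover have "ed a c \<in> edges n D" using t by (simp add: triangle_def)
  ultimately show "is_path n D (ed a c, [iarr c a b, iarr b c a])"
    by (simp add: is_path_def ed_commute)
  show "wt [iarr c a b, iarr b c a] + arrow_wt (iarr a b c) = 1"
    using arrow_wt_triangle[OF t] by simp
qed (simp add: ed_commute)

lemma incident_if_not_frozen: "ed a b \<in> edges n D \<Longrightarrow> ed a b \<notin> frozen n \<Longrightarrow> incident_diag D a"
  using in_ed_iff[of a a b] not_side_in_D[of "ed a b"] by (auto simp: incident_diag_def frozen_def)

lemma side_at:
  assumes "ed a b \<in> edges n D" "ed a b \<in> frozen n"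
  shows "b = succ a \<or> b = pred a"
  using assms ed_range[of a b] n3
  by (auto simp: frozen_def is_side_def ed_def succ_def pred_def min_def max_def split: if_splits)

text \<open>If both sides of the polygon at \<open>a\<close> belonged to the triangle, a diagonal at
  \<open>a\<close> would run between them and cross \<open>bc\<close>. Hence differentiating at an
  arrow around such a vertex yields a generator of the ideal.\<close>

lemma not_frozen_if_incident:
  assumes t: "triangle a b c" and inc: "incident_diag D a"
  shows "ed a b \<notin> frozen n \<or> ed a c \<notin> frozen n"
proof (rule ccontr)
  assume *: "\<not> ?thesis"
  note r = triangle_range[OF t] and a = incident_diag_range[OF inc]
  have "b \<noteq> pred a" using t not_ccw_pred[of c a] r unfolding triangle_def by blast
  then have b: "b = succ a" using * t side_at unfolding triangle_def by blast
  have "c \<noteq> succ a" using t not_ccw_succ[of b a] r unfolding triangle_def by blast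
  then have c: "c = pred a" using * t side_at unfolding triangle_def by blast
  obtain d where d: "d \<in> D" "a = fst d \<or> a = snd d" using inc by (auto simp: incident_diag_def)
  obtain u v where uv: "d = (u, v)" by (cases d)
  have dE: "(u, v) \<in> edges n D" using d uv by (simp add: edges_def)
  define y where "y = (if a = u then v else u)"
  have y: "ed a y = d" using edge_range[OF dE] d uv by (auto simp: y_def ed_def)
  have yr: "1 \<le> y" "y \<le> n" "a \<noteq> y" using ed_range[of a y] y dE uv by auto
  have "is_diagonal n d" using d triangulation by (auto simp: is_triangulation_def)
  then have "y \<noteq> succ a" "y \<noteq> pred a"
    unfolding y[symmetric] using a n3
    by (auto simp: is_diagonal_def ed_def min_def max_def succ_def pred_def split: if_splits)
  then have "ccw a b y" "ccw a y c" unfolding b c using ccw_succ ccw_pred a yr by auto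
  then show False using ccw_not_edges[of a b y c] y dE uv t unfolding triangle_def by auto
qed

text \<open>By \<open>wt_poly_mult\<close> the elements with vanishing polynomials form a two-sided
  ideal. It contains the generators, since the two terms of a derivative have the same ends and
  complete the same arrow to cycles of weight 1.\<close>

lemma Jideal_subset_kernel:
  assumes "(f :: path \<Rightarrow> 'a::field) \<in> Jideal n D"
  shows "f \<in> KQ n D" "wt_poly d e f = 0"
proof -
  let ?I = "{f \<in> KQ n D. \<forall>d e. wt_poly d e f = 0} :: (path \<Rightarrow> 'a) set"
  have tgt: "\<And>x. x \<in> arrows n D \<Longrightarrow> atgt x \<in> edges n D" using arrow_in_edges by blast
  have dW: "dW n D x \<in> ?I" if x: "x \<in> arrows n D" "asrc x \<notin> frozen n \<or> atgt x \<notin> frozen n" for x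
    using x(1)
  proof (cases rule: arrows_cases)
    case (internal a b c)
    have E: "ed a b \<in> edges n D" "ed a c \<in> edges n D" using internal(1) by (auto simp: triangle_def)
    \<comment> \<open>Both ends of the arrow are edges at \<open>a\<close>, and one of them is a
      diagonal.\<close>
    have inc: "incident_diag D a" using x(2) internal(2) incident_if_not_frozen E by auto
    obtain as bs where ab: "fan a (as @ iarr a b c # bs)" "chain (next_side n a) (as @ iarr a b c # bs)"
      "pend (next_side n a) as = ed a b" "pend (ed a c) bs = prev_side n a"
      and ab2: "earr a # as @ iarr a b c # bs \<in> big_cycles n D"
      "cder (earr a # as @ iarr a b c # bs) (iarr a b c) = [(ed a c, bs @ earr a # as)]"
      "\<And>T'. T' \<in> big_cycles n D \<Longrightarrow> iarr a b c \<in> set T' \<Longrightarrow> T' = earr a # as @ iarr a b c # bs"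
      using big_cycle_through[OF internal(1) inc] by blast
    note p = big_path_props[OF internal(1) inc ab] and q = triangle_path_props[OF internal(1)]
    have pK: "(kq_basis (ed a c, bs @ earr a # as) :: path \<Rightarrow> 'a) \<in> KQ n D" by (rule KQ_basis[OF p(1)])
    have qK: "(kq_basis (ed a c, [iarr c a b, iarr b c a]) :: path \<Rightarrow> 'a) \<in> KQ n D" by (rule KQ_basis[OF q(1)])
    have wt: "wt [iarr c a b, iarr b c a] = wt (bs @ earr a # as)" using p(3) q(3) by linarith
    have dW: "(dW n D (iarr a b c) :: path \<Rightarrow> 'a) =
      (\<lambda>p. kq_basis (ed a c, [iarr c a b, iarr b c a]) p - kq_basis (ed a c, bs @ earr a # as) p)"
      by (rule dW_eq[OF internal(1) inc ab2])
    show ?thesis unfolding internal(2) dW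
      using KQ_diff[OF qK pK] p(2) q(2) wt
      by (simp add: wt_poly_diff[OF qK pK] wt_poly_basis del: pend.simps wt_simps pend_append)
  next
    \<comment> \<open>External arrows join two sides of the polygon, so no relation arises from
      them.\<close>
    case (external a)
    then show ?thesis using x(2) prev_side_is_side next_side_is_side by (auto simp: frozen_def)
  qed
  have mult: "kq_mult g f \<in> ?I \<and> kq_mult f g \<in> ?I" if "f \<in> ?I" "g \<in> KQ n D" for f g
    using that wt_poly_mult[OF _ _ finite_edges tgt, of f g] wt_poly_mult[OF _ _ finite_edges tgt, of g f]
    by (simp add: KQ_mult)
  have "Jideal n D \<subseteq> ?I"
    unfolding Jideal_def kq_ideal_def
  proof (rule Inter_lower, rule CollectI, intro conjI ballI allI)
    show "{dW n D a |a. a \<in> arrows n D \<and> (asrc a \<notin> frozen n \<or> atgt a \<notin> frozen n)} \<subseteq> ?I" using dW by blast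
  qed (use mult in \<open>auto simp: KQ_zero wt_poly_zero kq_add_def KQ_add wt_poly_add KQ_smult wt_poly_smult\<close>)
  with assms show "f \<in> KQ n D" "wt_poly d e f = 0" by auto
qed

section \<open>Minimal cycles\<close>

lemma min_cycle_props:
  assumes "c \<in> min_cycles n D"
  obtains v where "is_path n D (v, c)" "pend v c = v" "wt c = 1" "c \<noteq> []"
proof -
  consider "c \<in> tri_cycles n D" | "c \<in> big_cycles n D" using assms by (auto simp: min_cycles_def)
  then show ?thesis
  proof cases
    case 1
    then obtain u v w where c: "c = [iarr u v w, iarr w u v, iarr v w u]" and t: "triangle u v w"
      unfolding tri_cycles_eq by blast
    note p = triangle_path_props[OF t]
    show ?thesis
    proof (rule that)
      have "ed u v \<in> edges n D" using t by (simp add: triangle_def)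
      then show "is_path n D (ed u v, c)"
        using p(1) triangle_arrow[OF t] unfolding c is_path_def by (simp add: ed_commute)
      show "pend (ed u v) c = ed u v" using p(2) unfolding c by simp
      show "wt c = 1" using p(3) unfolding c by simp
    qed (simp add: c)
  next
    case 2
    then obtain i as where c: "c = earr i # as" and as: "incident_diag D i" "fan i as"
      "chain (next_side n i) as" "pend (next_side n i) as = prev_side n i" unfolding big_cycles_eq by blast
    note i = incident_diag_range[OF as(1)]
    show ?thesis
    proof (rule that)
      have "earr i \<in> arrows n D" using as(1) i unfolding arrows_def external_arrows_def by blast
      then show "is_path n D (prev_side n i, c)" using fan_arrows[OF as(2)] as i unfolding c is_path_def
        by (simp add: side_in_edges prev_side_is_side)
      show "pend (prev_side n i) c = prev_side n i" using as(4) unfolding c by simp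
      have "wt as + of_bool (succ i < i) = of_bool (pred i < i)"
        by (rule fan_wt[OF as(2)]) (use as i in \<open>auto simp: next_side_ed prev_side_ed\<close>)
      moreover have "arrow_wt (earr i) = of_bool (i = 1 \<or> i = n)" using arrow_wt_external i by simp
      ultimately show "wt c = 1"
        using i n3 unfolding c by (auto simp: succ_def pred_def split: if_splits)
    qed (simp add: c)
  qed
qed

text \<open>Only a side of the polygon seen from outside has no triangle next to it, and this cannot
  happen for both directions of an edge because \<open>3 \<le> n\<close>.\<close>

lemma edge_in_triangle:
  assumes "e \<in> edges n D"
  obtains a b c where "triangle a b c" "e = ed a b"
proof -
  obtain s t where e: "e = (s, t)" by (cases e)
  have r: "1 \<le> s" "s < t" "t \<le> n" using edge_range assms e by auto
  have E: "e = ed s t" "e = ed t s" using r e by (auto simp: ed_less)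
  show ?thesis
  proof (cases "t = pred s")
    case False
    then show ?thesis using triangle_exists[of s t] that assms E(1) by metis
  next
    case True
    then have "s \<noteq> pred t" using r n3 by (auto simp: pred_def split: if_splits)
    then show ?thesis using triangle_exists[of t s] that assms E(2) by metis
  qed
qed

text \<open>Whatever the choice in \<open>Cpath\<close> picks is a rotation of a minimal cycle, and
  rotation does not change the weight. The triangles supply a cycle through every edge, so there is
  something to choose.\<close>

lemma Cpath_props:
  assumes v: "v \<in> edges n D"
  shows "is_path n D (Cpath n D v)" "fst (Cpath n D v) = v" "ptgt (Cpath n D v) = v" "wt (snd (Cpath n D v)) = 1"
proof -
  let ?P = "\<lambda>p. \<exists>c k. c \<in> min_cycles n D \<and> k < length c \<and> asrc (rotate k c ! 0) = v \<and> p = (v, rotate k c)"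
  obtain a b c where t: "triangle a b c" and vab: "v = ed a b" using edge_in_triangle[OF v] .
  have "\<exists>p. ?P p"
  proof -
    obtain T where T: "T \<in> tri_cycles n D" "cder T (iarr a b c) = [(ed a c, [iarr c a b, iarr b c a])]"
      using tri_cycle_through[OF t] by blast
    then have "iarr a b c \<in> set T" using cder_empty by fastforce
    then obtain k where k: "k < length T" "T ! k = iarr a b c" by (auto simp: in_set_conv_nth)
    then have "rotate k T ! 0 = iarr a b c" by (simp add: rotate_drop_take nth_append)
    then have "?P (v, rotate k T)" using T(1) k vab unfolding min_cycles_def
      by (intro exI[of _ T] exI[of _ k]) simp
    then show ?thesis by blast
  qed
  then have "?P (Cpath n D v)" unfolding Cpath_def by (rule someI_ex)
  then obtain T k where T: "T \<in> min_cycles n D" "k < length T" "asrc (rotate k T ! 0) = v"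
    and C: "Cpath n D v = (v, rotate k T)" by blast
  obtain w where w: "is_path n D (w, T)" "pend w T = w" "wt T = 1" using min_cycle_props[OF T(1)] .
  define xs ys where "xs = take k T" and "ys = drop k T"
  have Txy: "T = xs @ ys" and rot: "rotate k T = ys @ xs" and ne: "ys \<noteq> []"
    using T(2) by (simp_all add: xs_def ys_def rotate_drop_take)
  have "asrc (ys ! 0) = v" using T(3) ne unfolding rot by (simp add: nth_append)
  moreover have "chain (pend w xs) ys" "chain w xs" using w(1) unfolding Txy is_path_def by auto
  ultimately have "pend w xs = v" using ne by (cases ys) auto
  then show "is_path n D (Cpath n D v)" "fst (Cpath n D v) = v" "ptgt (Cpath n D v) = v"
    "wt (snd (Cpath n D v)) = 1"
    using w v unfolding C rot unfolding Txy is_path_def by auto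
qed

end

section \<open>Paths starting at a side\<close>

context triangulated_polygon
begin

lemma edge_range_fst_snd: "e \<in> edges n D \<Longrightarrow> fst e < snd e \<and> 1 \<le> fst e \<and> snd e \<le> n"
  using edge_range[of "fst e" "snd e"] by simp

text \<open>Row \<open>n\<close> of \<open>\<Lambda>\<close> and of \<open>(s, t)\<close> corresponds to the side \<open>(1, n)\<close> only up to one power of \<open>x\<close>,
  since column \<open>n\<close> of \<open>\<Lambda>\<close> is \<open>x\<close> to the power -1 times \<open>(1, n)\<close>: paths from side \<open>i\<close> to \<open>e\<close> of weight \<open>k\<close>
  exist iff \<open>min_wt i e \<le> k + col_shift i\<close>.\<close>
definition min_wt :: "nat \<Rightarrow> edge \<Rightarrow> nat" where
  "min_wt i e = (if i \<le> fst e then 0 else if i \<le> snd e then 1 else 2)"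

definition col_shift :: "nat \<Rightarrow> nat" where
  "col_shift i = of_bool (i = n)"

text \<open>Adding \<open>n\<close> times the level gives the sum of the two coordinates of the
  lift, which grows along every arrow. Up to a constant this is the measure of the inductions
  below.\<close>

definition height :: "edge \<Rightarrow> nat" where
  "height e = fst e + snd e"

text \<open>Breaks the cyclic symmetry once and for all, so that the estimates for single arrows
  become linear arithmetic.\<close>

lemma arrow_forms:
  assumes "x \<in> arrows n D"
  obtains u v w where "1 \<le> u" "u < v" "v < w" "w \<le> n" "asrc x = (u,v)" "atgt x = (u,w)"
  | u v w where "1 \<le> u" "u < v" "v < w" "w \<le> n" "asrc x = (u,w)" "atgt x = (v,w)"
  | u v w where "1 \<le> u" "u < v" "v < w" "w \<le> n" "asrc x = (v,w)" "atgt x = (u,v)"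
  | i where "2 \<le> i" "i < n" "asrc x = (i - 1, i)" "atgt x = (i, Suc i)"
  | "asrc x = (n - 1, n)" "atgt x = (1, n)"
  | "asrc x = (1, n)" "atgt x = (1, 2)"
  using assms
proof (cases rule: arrows_cases)
  case (internal a b c)
  note r = triangle_range[OF internal(1)]
  consider "a < b" "b < c" | "b < c" "c < a" | "c < a" "a < b"
    using internal(1) unfolding triangle_def ccw_def by blast
  then show ?thesis
  proof cases
    case 1
    then show ?thesis using that(1)[of a b c] internal(2) r by (simp add: ed_less)
  next
    case 2
    then show ?thesis using that(2)[of b c a] internal(2) r by (simp add: ed_less)
  next
    case 3
    then show ?thesis using that(3)[of c a b] internal(2) r by (simp add: ed_less)
  qed
next
  case (external a)
  consider "a = 1" | "a = n" | "2 \<le> a" "a < n" using external by linarith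
  then show ?thesis
  proof cases
    case 1
    then show ?thesis using that(6) external(4) n3 by (simp add: next_side_def prev_side_def numeral_2_eq_2)
  next
    case 2
    then show ?thesis using that(5) external(4) n3 by (simp add: next_side_def prev_side_def)
  next
    case 3
    then show ?thesis using that(4)[of a] external(4) n3 by (simp add: next_side_def prev_side_def)
  qed
qed

text \<open>\<open>min_wt i e\<close> is the least level at which the smaller coordinate of the lift
  of \<open>e\<close> is at least \<open>i\<close>, and this coordinate never decreases along an
  arrow.\<close>

lemma min_wt_arrow:
  assumes "x \<in> arrows n D" "1 \<le> i" "i \<le> n"
  shows "min_wt i (atgt x) \<le> min_wt i (asrc x) + arrow_wt x"
  using assms(1) by (cases rule: arrow_forms) (use assms n3 in \<open>simp_all add: min_wt_def arrow_wt_def\<close>)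

lemma height_arrow:
  assumes "x \<in> arrows n D"
  shows "height (asrc x) < height (atgt x) + n * arrow_wt x"
  using assms by (cases rule: arrow_forms) (use n3 in \<open>auto simp: height_def arrow_wt_def\<close>)

lemma min_wt_path:
  assumes "set as \<subseteq> arrows n D" "chain v as" "1 \<le> i" "i \<le> n"
  shows "min_wt i (pend v as) \<le> min_wt i v + wt as"
  using assms(1,2)
proof (induction as arbitrary: v)
  case (Cons x as)
  then show ?case using min_wt_arrow[of x i] assms(3,4) by fastforce
qed simp

lemma height_path:
  assumes "set as \<subseteq> arrows n D" "chain v as"
  shows "height v + length as \<le> height (pend v as) + n * wt as"
  using assms
proof (induction as arbitrary: v)
  case (Cons x as)
  then show ?case using height_arrow[of x] by (fastforce simp: algebra_simps)
qed simp

lemma min_wt_next_side: "1 \<le> i \<Longrightarrow> i \<le> n \<Longrightarrow> min_wt i (next_side n i) \<le> col_shift i"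
  using n3 by (auto simp: min_wt_def col_shift_def next_side_def)

lemma col_shift_le_min_wt: "e \<in> edges n D \<Longrightarrow> col_shift i \<le> min_wt i e"
  using edge_range_fst_snd[of e] by (auto simp: min_wt_def col_shift_def)

lemma min_wt_le_wt:
  assumes "is_path n D (next_side n i, as)" "1 \<le> i" "i \<le> n"
  shows "min_wt i (pend (next_side n i) as) \<le> wt as + col_shift i"
  using min_wt_path[of as "next_side n i" i] min_wt_next_side[of i] assms by (auto simp: is_path_def)

text \<open>Without a diagonal only the two sides meet at \<open>a\<close>, so the triangle on one
  of them must contain the other.\<close>

lemma triangle_at_ear:
  assumes "1 \<le> a" "a \<le> n" "\<not> incident_diag D a"
  shows "triangle a (succ a) (pred a)"
proof -
  have E: "ed a (succ a) \<in> edges n D"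
    using side_in_edges[OF next_side_is_side[of a]] next_side_ed[of a] assms by simp
  have "succ a \<noteq> pred a" using n3 assms by (auto simp: succ_def pred_def)
  then obtain c where c: "triangle a (succ a) c" using triangle_exists[OF E] by blast
  have "ed a c \<in> edges n D" using c by (simp add: triangle_def)
  then have "c = succ a \<or> c = pred a" using side_at incident_if_not_frozen assms by blast
  with c show ?thesis using triangle_range[OF c] by auto
qed

text \<open>Takes one step back without letting the smaller coordinate of the lift fall below
  \<open>i\<close>. An arrow turning about the smaller endpoint preserves that coordinate. If no
  triangle provides one, \<open>e\<close> is the side following \<open>a\<close> and the step lowers
  the coordinate by one, which is harmless unless \<open>e\<close> is the start.\<close>

lemma last_arrow_exists:
  assumes e: "e \<in> edges n D" and i: "1 \<le> i" "i \<le> n" and reach: "min_wt i e \<le> k + col_shift i"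
    and ne: "\<not> (e = next_side n i \<and> k = 0)"
  obtains x where "x \<in> arrows n D" "atgt x = e" "arrow_wt x \<le> k" "min_wt i (asrc x) + arrow_wt x \<le> k + col_shift i"
proof -
  obtain s t where st: "e = (s, t)" by (cases e)
  note r = edge_range[OF e[unfolded st]]
  \<comment> \<open>\<open>a\<close> is the smaller coordinate of the lift of \<open>e\<close> at level \<open>k + col_shift i\<close> (from level 2 on
    there is nothing to check, so either endpoint would do).\<close>
  define a where "a = (if k + col_shift i = 1 then t else s)"
  define b where "b = (if k + col_shift i = 1 then s else t)"
  have eab: "e = ed a b" using r st by (simp add: a_def b_def ed_less)
  have rab: "1 \<le> a" "a \<le> n" "1 \<le> b" "b \<le> n" using r by (auto simp: a_def b_def)
  have it: "i \<le> t" if "k + col_shift i = 1" using that reach st r by (auto simp: min_wt_def split: if_splits)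
  have is0: "i \<le> s" if "k + col_shift i = 0" using that reach st by (auto simp: min_wt_def split: if_splits)
  have dln: "i < n" if "col_shift i = 0" using that i by (auto simp: col_shift_def split: if_splits)
  have dln': "i = n" if "col_shift i \<noteq> 0" using that by (auto simp: col_shift_def split: if_splits)
  have dl1: "col_shift i \<le> 1" by (simp add: col_shift_def)
  show ?thesis
  proof (cases "b = succ a")
    case False
    then obtain d where d: "triangle a d b" using triangle_exists'[of a b] e eab by metis
    note rd = triangle_range[OF d]
    have ccw: "ccw a d b" using d by (simp add: triangle_def)
    have "arrow_wt (iarr a d b) \<le> k \<and> min_wt i (ed a d) + arrow_wt (iarr a d b) \<le> k + col_shift i"
    proof (cases "k + col_shift i = 1")
      case True
      then have "a = t" "b = s" by (auto simp: a_def b_def)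
      then have "t < d \<or> d < s" using ccw r by (auto simp: ccw_def)
      moreover have "k = 1" if "t < d"
      proof -
        have "i < n" using it[OF True] that rd by linarith
        with True show ?thesis by (simp add: col_shift_def)
      qed
      ultimately show ?thesis
        using True it[OF True] r rd \<open>a = t\<close> \<open>b = s\<close>
        by (cases "t < d") (auto simp: ed_less arrow_wt_def min_wt_def)
    next
      case False
      then have "a = s" "b = t" by (auto simp: a_def b_def)
      then have "s < d" "d < t" using ccw r by (auto simp: ccw_def)
      moreover have "i \<le> s \<or> 2 \<le> k + col_shift i" using False is0 by linarith
      ultimately show ?thesis
        using r rd \<open>a = s\<close> \<open>b = t\<close>
        by (auto simp: ed_less arrow_wt_def min_wt_def)
    qed
    then show ?thesis using that[of "iarr a d b"] triangle_arrow[OF d] eab by simp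
  next
    case True
    have en: "e = next_side n a" using eab True rab by (simp add: next_side_ed)
    have st': "a = s \<and> t = Suc s \<and> s < n \<and> k + col_shift i \<noteq> 1 \<or> a = n \<and> s = 1 \<and> t = n \<and> k + col_shift i = 1"
      using True r n3 by (auto simp: a_def b_def succ_def split: if_splits)
    have ia: "i \<noteq> a" if "k = 0" using ne en that by auto
    \<comment> \<open>In every case the smaller coordinate of the lift of \<open>e\<close> exceeds
      \<open>i\<close>; equality would make the lift the start itself.\<close>
    have c: "a = s \<and> t = Suc s \<and> s < n \<and> (k = 0 \<and> col_shift i = 0 \<and> i < s \<or> 2 \<le> k + col_shift i \<and> 1 \<le> k) \<or>
        a = n \<and> s = 1 \<and> t = n \<and> k = 1 \<and> col_shift i = 0 \<and> i < n"
    proof (cases "k + col_shift i = 1")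
      case True
      have "col_shift i = 0"
      proof (rule ccontr)
        assume "col_shift i \<noteq> 0"
        then have "i = n" "k = 0" using True dln' by simp_all
        with ia st' True show False by simp
      qed
      with st' True dln show ?thesis by simp
    next
      case False
      then have "k + col_shift i = 0 \<or> 2 \<le> k + col_shift i" by linarith
      then show ?thesis using st' False ia is0 dl1 by fastforce
    qed
    show ?thesis
    proof (cases "incident_diag D a")
      case inc: True
      have "earr a \<in> arrows n D" using inc rab unfolding arrows_def external_arrows_def by blast
      moreover have "arrow_wt (earr a) \<le> k \<and> min_wt i (prev_side n a) + arrow_wt (earr a) \<le> k + col_shift i"
        unfolding arrow_wt_external[OF rab(1,2)]
        using c n3 i by (auto simp: min_wt_def prev_side_def)
      ultimately show ?thesis using that[of "earr a"] en by simp
    next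
      case False
      \<comment> \<open>An ear has no external arrow. The arrow from the edge joining its two
        neighbours takes its place.\<close>
      have t: "triangle a b (pred a)" using triangle_at_ear[OF rab(1,2) False] True by simp
      note t' = triangle_rotate[OF t]
      have "arrow_wt (iarr b (pred a) a) \<le> k \<and> min_wt i (ed b (pred a)) + arrow_wt (iarr b (pred a) a) \<le> k + col_shift i"
        using c n3 i True
        by (auto simp: min_wt_def ed_def arrow_wt_def pred_def succ_def)
      then show ?thesis using that[of "iarr b (pred a) a"] triangle_arrow[OF t'] eab by (simp add: ed_commute)
    qed
  qed
qed

text \<open>Follow \<open>last_arrow_exists\<close> backwards from \<open>e\<close>: the sum of the
  lifted coordinates drops at each step, so the walk must arrive at the starting side.\<close>

lemma path_exists:
  assumes e: "e \<in> edges n D" and i: "1 \<le> i" "i \<le> n" and reach: "min_wt i e \<le> k + col_shift i"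
  obtains as where "is_path n D (next_side n i, as)" "pend (next_side n i) as = e" "wt as = k"
proof -
  have "\<exists>as. is_path n D (next_side n i, as) \<and> pend (next_side n i) as = e \<and> wt as = k"
    using e reach
  proof (induction "height e + n * k" arbitrary: e k rule: less_induct)
    case less
    show ?case
    proof (cases "e = next_side n i \<and> k = 0")
      case True
      with less.prems show ?thesis by (intro exI[of _ "[]"]) (simp add: is_path_def)
    next
      case False
      obtain x where x: "x \<in> arrows n D" "atgt x = e" "arrow_wt x \<le> k"
        "min_wt i (asrc x) + arrow_wt x \<le> k + col_shift i"
        using last_arrow_exists[OF less.prems(1) i less.prems(2) False] .
      have "height (asrc x) + n * (k - arrow_wt x) < height e + n * k"
        using height_arrow[OF x(1)] mult_le_mono2[OF x(3), of n] unfolding x(2) diff_mult_distrib2 by linarith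
      moreover have "asrc x \<in> edges n D" using arrow_in_edges[OF x(1)] by simp
      moreover have "min_wt i (asrc x) \<le> k - arrow_wt x + col_shift i" using x(3,4) by linarith
      ultimately obtain as where "is_path n D (next_side n i, as)" "pend (next_side n i) as = asrc x"
        "wt as = k - arrow_wt x" using less.hyps[of "asrc x" "k - arrow_wt x"] by blast
      with x show ?thesis by (intro exI[of _ "as @ [x]"]) (simp add: is_path_def)
    qed
  qed
  with that show ?thesis by blast
qed

section \<open>Two arrows into the same edge\<close>

definition turns :: "nat \<Rightarrow> arrow \<Rightarrow> bool" where
  "turns a x \<longleftrightarrow> (\<exists>b c. triangle a b c \<and> x = iarr a b c) \<or> (incident_diag D a \<and> x = earr a)"

lemma arrow_turns:
  assumes "x \<in> arrows n D"
  obtains a b where "turns a x" "atgt x = ed a b"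
  using assms
proof (cases rule: arrows_cases)
  case (internal a b c)
  then show ?thesis using that[of a c] by (auto simp: turns_def)
next
  case (external a)
  then show ?thesis using that[of a "succ a"] by (simp add: turns_def next_side_ed)
qed

lemma turns_next_side:
  assumes "turns a x" "atgt x = next_side n a" "1 \<le> a" "a \<le> n"
  shows "incident_diag D a \<and> x = earr a"
proof (rule ccontr)
  assume "\<not> ?thesis"
  then obtain b c where t: "triangle a b c" "x = iarr a b c" using assms(1) by (auto simp: turns_def)
  then have "c = succ a" using assms by (auto simp: next_side_ed ed_eq_iff)
  with t(1) not_ccw_succ[of b a] triangle_range[OF t(1)] show False by (simp add: triangle_def)
qed

text \<open>At most one triangle precedes an edge around \<open>a\<close>, and before the next side
  at \<open>a\<close> only the external arrow remains. Different arrows into an edge therefore turn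
  about different endpoints.\<close>

lemma turns_unique:
  assumes x: "turns a x" and y: "turns a y" and tgt: "atgt x = atgt y" and a: "1 \<le> a" "a \<le> n"
  shows "x = y"
proof (cases "atgt x = next_side n a")
  case True
  then show ?thesis using turns_next_side x y tgt a by metis
next
  case False
  then obtain b c where t: "triangle a b c" "x = iarr a b c" using x by (auto simp: turns_def)
  obtain b' c' where t': "triangle a b' c'" "y = iarr a b' c'" using y False tgt by (auto simp: turns_def)
  have "c = c'" using tgt t(2) t'(2) by (auto simp: ed_eq_iff)
  with t t' triangle_unique' show ?thesis by blast
qed

text \<open>The derivative at the arrow from \<open>ab\<close> to \<open>ac\<close> equates two ways
  back from \<open>ac\<close> to \<open>ab\<close>: through the third side of the triangle, and
  around \<open>a\<close> through the exterior. The second arrives turning about \<open>a\<close>,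
  so its last arrow has to be \<open>x\<close>.\<close>

lemma turning_relation:
  fixes T :: "'a::field itself"
  assumes t: "triangle a b c" and inc: "incident_diag D a" and x: "turns a x" "atgt x = ed a b"
  obtains as where "is_path n D (ed a c, as @ [x])" "pend (ed a c) (as @ [x]) = ed a b"
    "wt (as @ [x]) = wt [iarr c a b, iarr b c a]"
    "path_eq T n D (ed a c) [iarr c a b, iarr b c a] (as @ [x])"
proof -
  note a = incident_diag_range[OF inc]
  obtain as bs where ab: "fan a (as @ iarr a b c # bs)" "chain (next_side n a) (as @ iarr a b c # bs)"
    "pend (next_side n a) as = ed a b" "pend (ed a c) bs = prev_side n a"
    and ab2: "earr a # as @ iarr a b c # bs \<in> big_cycles n D"
    "cder (earr a # as @ iarr a b c # bs) (iarr a b c) = [(ed a c, bs @ earr a # as)]"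
    "\<And>T'. T' \<in> big_cycles n D \<Longrightarrow> iarr a b c \<in> set T' \<Longrightarrow> T' = earr a # as @ iarr a b c # bs"
    using big_cycle_through[OF t inc] by blast
  note p = big_path_props[OF t inc ab] and q = triangle_path_props[OF t]
  \<comment> \<open>The last arrow is the external one if \<open>ab\<close> is the next side at
    \<open>a\<close>, so that no fan follows it.\<close>
  obtain ys y where ys: "bs @ earr a # as = ys @ [y]" and y: "turns a y"
  proof (cases as rule: rev_cases)
    case Nil
    then show ?thesis using that[of bs "earr a"] inc by (simp add: turns_def)
  next
    case (snoc as' z)
    have "fan a [z]" using ab(1) snoc by simp
    then show ?thesis using that[of "bs @ earr a # as'" z] snoc by (auto simp: turns_def)
  qed
  have "atgt y = ed a b" using p(2) unfolding ys by simp
  then have "y = x" using turns_unique[OF y x(1)] x(2) a by simp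
  then have eq: "bs @ earr a # as = ys @ [x]" using ys by simp
  have "iarr a b c \<in> arrows n D" by (rule triangle_arrow[OF t])
  moreover have "asrc (iarr a b c) \<notin> frozen n \<or> atgt (iarr a b c) \<notin> frozen n"
    using not_frozen_if_incident[OF t inc] by simp
  ultimately have "(dW n D (iarr a b c) :: path \<Rightarrow> 'a) \<in> Jideal n D" by (rule dW_in_Jideal)
  moreover have "(dW n D (iarr a b c) :: path \<Rightarrow> 'a) =
      (\<lambda>p. kq_basis (ed a c, [iarr c a b, iarr b c a]) p - kq_basis (ed a c, bs @ earr a # as) p)"
    by (rule dW_eq[OF t inc ab2])
  ultimately have "path_eq T n D (ed a c) [iarr c a b, iarr b c a] (ys @ [x])"
    unfolding path_eq_def eq by simp
  moreover have "wt (ys @ [x]) = wt [iarr c a b, iarr b c a]" using p(3) q(3) unfolding eq by linarith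
  ultimately show ?thesis using that[of ys] p(1,2) unfolding eq by blast
qed

text \<open>The bound is the point: \<open>ac\<close>, where the relation starts, must be reachable
  from side \<open>i\<close> with the weight left over. If \<open>a\<close> is the smaller
  coordinate of the lift of \<open>e\<close>, the lifts of \<open>ac\<close> and of the source
  \<open>bc\<close> of the internal arrow share their smaller coordinate, and the bound for
  \<open>bc\<close> carries over.\<close>

lemma relation_at_common_target:
  assumes xy: "x \<in> arrows n D" "y \<in> arrows n D" "x \<noteq> y" "atgt x = e" "atgt y = e" and i: "1 \<le> i" "i \<le> n"
    and bx: "min_wt i (asrc x) + arrow_wt x \<le> K" and by1: "min_wt i (asrc y) + arrow_wt y \<le> K"
  obtains a b c where "incident_diag D a" "triangle a b c" "e = ed a b"
    "turns a x \<and> y = iarr b c a \<or> turns a y \<and> x = iarr b c a"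
    "min_wt i (ed a c) + arrow_wt (iarr c a b) + arrow_wt (iarr b c a) \<le> K"
proof -
  have E: "e \<in> edges n D" using arrow_in_edges[OF xy(1)] xy(4) by simp
  obtain u v where u: "turns u x" "e = ed u v" using arrow_turns[OF xy(1)] xy(4) by metis
  obtain u' v' where u': "turns u' y" "e = ed u' v'" using arrow_turns[OF xy(2)] xy(5) by metis
  have r: "u \<noteq> v" "1 \<le> u" "u \<le> n" "1 \<le> v" "v \<le> n" using ed_range[of u v] E u(2) by auto
  have "u \<noteq> u'" using turns_unique[of u x y] u u' xy r by auto
  then have v: "u' = v" "v' = u" using u(2) u'(2) by (auto simp: ed_eq_iff)
  have both: "\<exists>x' y'. turns a x' \<and> turns b y' \<and> atgt x' = e \<and> atgt y' = e \<and> y' \<in> {x, y} \<and> {x', y'} = {x, y} \<and>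
      min_wt i (asrc x') + arrow_wt x' \<le> K \<and> min_wt i (asrc y') + arrow_wt y' \<le> K"
    if "e = ed a b" for a b
  proof -
    have "a = u \<and> b = v \<or> a = v \<and> b = u" using that u(2) by (auto simp: ed_eq_iff)
    then show ?thesis using u(1) u'(1) v xy bx by1 by blast
  qed
  show ?thesis
  proof (cases "e \<in> frozen n")
    case True
    \<comment> \<open>The endpoint is forced here, as the arrow turning about \<open>a\<close> into
      the side following \<open>a\<close> is external. If \<open>a\<close> is the larger coordinate
      of the lift, \<open>ac\<close> shares its smaller coordinate with the source of that arrow
      instead.\<close>
    then obtain a where a: "1 \<le> a" "a \<le> n" "e = next_side n a" using side_cases unfolding frozen_def by blast
    define b where "b = succ a"
    have eab: "e = ed a b" using a by (simp add: next_side_ed b_def)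
    obtain x' y' where x'y': "turns a x'" "turns b y'" "atgt x' = e" "atgt y' = e" "{x', y'} = {x, y}"
      "min_wt i (asrc x') + arrow_wt x' \<le> K" "min_wt i (asrc y') + arrow_wt y' \<le> K" using both[OF eab] by blast
    have x': "incident_diag D a" "x' = earr a" using turns_next_side x'y' a by auto
    have b: "1 \<le> b" "b \<le> n" "a \<noteq> b" using a n3 by (auto simp: b_def succ_def)
    have "e \<noteq> next_side n b" using a b next_side_inj by metis
    then obtain c d where t: "triangle b c d" "y' = iarr b c d" using x'y'(2,4) by (auto simp: turns_def)
    have "d = a" using x'y'(4) t(2) eab b by (auto simp: ed_eq_iff)
    then have t': "triangle a b c" using triangle_rotate[OF triangle_rotate[OF t(1)]] by simp
    note rt = triangle_range[OF t']
    have ccw: "ccw a b c" using t' by (simp add: triangle_def)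
    have "min_wt i (ed a c) + arrow_wt (iarr c a b) + arrow_wt (iarr b c a) \<le> K"
      using x'y'(6,7) ccw a i rt n3 unfolding x'(2) t(2) \<open>d = a\<close> arrow_wt_external[OF a(1,2)] asrc.simps
      unfolding b_def by (auto simp: min_wt_def ed_def arrow_wt_def prev_side_def succ_def ccw_def min_def max_def split: if_splits)
    then show ?thesis
      using that[OF x'(1) t' eab] x'y'(1,5) t(2) \<open>d = a\<close> xy(3) by (metis doubleton_eq_iff)
  next
    case False
    define s t where "s = fst e" and "t = snd e"
    have st: "e = ed s t" "e = ed t s" "s < t" "1 \<le> s" "t \<le> n"
      using edge_range_fst_snd[OF E] by (auto simp: s_def t_def ed_less)
    \<comment> \<open>At level 1 the lift of \<open>e\<close> is \<open>(t, s + n)\<close>, at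
      levels 0 and 2 it starts from \<open>s\<close>. Beyond that either choice works, because
      \<open>min_wt\<close> is at most 2 and the two arrows weigh at most 1 together.\<close>
    define a where "a = (if K = 1 then t else s)"
    define b where "b = (if K = 1 then s else t)"
    have eab: "e = ed a b" "e = ed b a" using st by (simp_all add: a_def b_def)
    obtain x' y' where x'y': "turns a x'" "turns b y'" "atgt x' = e" "atgt y' = e" "{x', y'} = {x, y}"
      "min_wt i (asrc x') + arrow_wt x' \<le> K" "min_wt i (asrc y') + arrow_wt y' \<le> K" using both[OF eab(1)] by blast
    have inc: "incident_diag D a" using incident_if_not_frozen E False eab by blast
    have b: "1 \<le> b" "b \<le> n" "a \<noteq> b" using st by (auto simp: b_def a_def)
    have "e \<noteq> next_side n b" using False next_side_is_side b unfolding frozen_def by auto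
    then obtain c d where t: "triangle b c d" "y' = iarr b c d" using x'y'(2,4) by (auto simp: turns_def)
    have "d = a" using x'y'(4) t(2) eab b by (auto simp: ed_eq_iff)
    then have t': "triangle a b c" using triangle_rotate[OF triangle_rotate[OF t(1)]] by simp
    note rt = triangle_range[OF t']
    have ccw: "ccw a b c" using t' by (simp add: triangle_def)
    have "min_wt i (ed a c) + arrow_wt (iarr c a b) + arrow_wt (iarr b c a) \<le> K"
    proof (cases "K = 1")
      case True
      then have ab: "a = t" "b = s" by (auto simp: a_def b_def)
      then have "s < c" "c < t" using ccw st by (auto simp: ccw_def)
      then show ?thesis
        using x'y'(7) True st unfolding t(2) \<open>d = a\<close> ab asrc.simps
        by (auto simp: ed_less arrow_wt_def min_wt_def split: if_splits)
    next
      case False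
      then have ab: "a = s" "b = t" by (auto simp: a_def b_def)
      then have "t < c \<or> c < s" using ccw st by (auto simp: ccw_def)
      then show ?thesis
        using x'y'(7) False st unfolding t(2) \<open>d = a\<close> ab asrc.simps
        by (cases "t < c") (auto simp: ed_less arrow_wt_def min_wt_def split: if_splits)
    qed
    then show ?thesis
      using that[OF inc t' eab(1)] x'y'(1,5) t(2) \<open>d = a\<close> xy(3) by (metis doubleton_eq_iff)
  qed
qed

text \<open>With \<open>m\<close> leading to \<open>ac\<close>, the induction hypothesis makes
  \<open>p'\<close> congruent to \<open>m\<close> followed by the arrow to \<open>bc\<close>, and
  \<open>q'\<close> to \<open>m\<close> followed by the way around \<open>a\<close>; the relation
  connects the two.\<close>

lemma path_eq_of_wt_eq:
  fixes T :: "'a::field itself"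
  assumes "is_path n D (next_side n i, p)" "is_path n D (next_side n i, q)"
    "pend (next_side n i) p = e" "pend (next_side n i) q = e" "wt p = wt q" and i: "1 \<le> i" "i \<le> n"
  shows "path_eq T n D (next_side n i) p q"
  using assms(1-5)
proof (induction "height e + n * wt p" arbitrary: e p q rule: less_induct)
  case less
  let ?f = "next_side n i"
  have fE: "?f \<in> edges n D" using side_in_edges next_side_is_side i by blast
  \<comment> \<open>A closed path of weight 0 is empty, since the lifted coordinates grow along
    every arrow.\<close>
  have short: "q' = []" if "is_path n D (?f, [])" "is_path n D (?f, q')" "pend ?f q' = ?f" "wt q' = 0" for q'
    using height_path[of q' ?f] that by (auto simp: is_path_def)
  show ?case
  proof (cases "p = [] \<or> q = []")
    case True
    then have "p = q" using short[of p] short[of q] less.prems by auto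
    then show ?thesis by (simp add: path_eq_refl)
  next
    case False
    obtain p' y where p: "p = p' @ [y]" using False by (cases p rule: rev_cases) auto
    obtain q' x where q: "q = q' @ [x]" using False by (cases q rule: rev_cases) auto
    have p': "is_path n D (?f, p')" "pend ?f p' = asrc y" "y \<in> arrows n D" "atgt y = e"
      and q': "is_path n D (?f, q')" "pend ?f q' = asrc x" "x \<in> arrows n D" "atgt x = e"
      using less.prems by (auto simp: is_path_def p q)
    have height: "height (asrc z) + n * k < height e + n * wt p"
      if "z \<in> arrows n D" "atgt z = e" "k + arrow_wt z = wt p" for z k
      using height_arrow[OF that(1)] that(2) that(3)[symmetric] by (simp add: algebra_simps)
    have single: "is_path n D (asrc z, [z])" if "z \<in> arrows n D" for z
      using arrow_in_edges[OF that] that by (simp add: is_path_def)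
    \<comment> \<open>Stated for arbitrary paths because either of the two given arrows may be the
      one that turns about \<open>a\<close>.\<close>
    have step: "path_eq T n D ?f (p' @ [y]) (q' @ [x])"
      if *: "is_path n D (?f, p')" "pend ?f p' = asrc y" "y \<in> arrows n D" "atgt y = e"
        "is_path n D (?f, q')" "pend ?f q' = asrc x" "x \<in> arrows n D" "atgt x = e"
        "wt (p' @ [y]) = wt p" "wt (q' @ [x]) = wt p"
        and t: "incident_diag D a" "triangle a b c" "e = ed a b" "turns a x" "y = iarr b c a"
        "min_wt i (ed a c) + arrow_wt (iarr c a b) + arrow_wt (iarr b c a) \<le> wt p + col_shift i"
      for p' q' x y a b c
    proof -
      have ac: "ed a c \<in> edges n D" using t(2) by (simp add: triangle_def)
      obtain as where as: "is_path n D (ed a c, as @ [x])" "pend (ed a c) (as @ [x]) = ed a b"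
        "wt (as @ [x]) = wt [iarr c a b, iarr b c a]"
        "path_eq T n D (ed a c) [iarr c a b, iarr b c a] (as @ [x])"
        using turning_relation[OF t(2,1,4), of T] *(8) t(3) by metis
      let ?k = "wt p - arrow_wt (iarr c a b) - arrow_wt (iarr b c a)"
      \<comment> \<open>The subtractions in \<open>?k\<close> are exact: \<open>col_shift i\<close>
        is at most \<open>min_wt\<close>, so the bound leaves at most \<open>wt p\<close> for the
        two arrows.\<close>
      have k: "?k + arrow_wt (iarr c a b) + arrow_wt (iarr b c a) = wt p"
        using t(6) col_shift_le_min_wt[OF ac, of i] by linarith
      then have "min_wt i (ed a c) \<le> ?k + col_shift i" using t(6) by linarith
      then obtain m where m: "is_path n D (?f, m)" "pend ?f m = ed a c" "wt m = ?k"
        using path_exists[OF ac i] by blast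
      have cab: "iarr c a b \<in> arrows n D"
        using triangle_arrow triangle_rotate[OF triangle_rotate[OF t(2)]] by blast
      have hy: "is_path n D (?f, m @ [iarr c a b])" using m cab by (auto simp: is_path_def ed_commute)
      have "path_eq T n D ?f p' (m @ [iarr c a b])"
      proof (rule less.hyps[OF _ *(1) hy *(2)])
        show "height (asrc y) + n * wt p' < height e + n * wt p" using height[OF *(3,4)] *(9) by simp
        show "pend ?f (m @ [iarr c a b]) = asrc y" using t(5) by (simp add: ed_commute)
        show "wt p' = wt (m @ [iarr c a b])" using *(9) k m(3) t(5) by simp
      qed
      then have 1: "path_eq T n D ?f (p' @ [y]) ((m @ [iarr c a b]) @ [y])"
        by (rule path_eq_append_right[OF _ *(2) _ single[OF *(3)]]) (simp add: t(5) ed_commute)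
      have 2: "path_eq T n D ?f (m @ [iarr c a b, y]) (m @ (as @ [x]))"
        by (rule path_eq_append_left[OF _ m(1)]) (use as(4) m(2) t(5) in simp)
      have xs: "pend (ed a c) as = asrc x" using as(1) by (simp add: is_path_def)
      have mas: "is_path n D (?f, m @ as)" using m as(1) by (auto simp: is_path_def)
      have "path_eq T n D ?f q' (m @ as)"
      proof (rule less.hyps[OF _ *(5) mas *(6)])
        show "height (asrc x) + n * wt q' < height e + n * wt p" using height[OF *(7,8)] *(10) by simp
        show "pend ?f (m @ as) = asrc x" using m(2) xs by simp
        show "wt q' = wt (m @ as)" using *(10) k m(3) as(3) by simp
      qed
      then have "path_eq T n D ?f (q' @ [x]) ((m @ as) @ [x])"
        by (rule path_eq_append_right[OF _ *(6) _ single[OF *(7)]]) (simp add: m(2) xs)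
      from path_eq_sym[OF this] have 3: "path_eq T n D ?f (m @ (as @ [x])) (q' @ [x])" by simp
      from 1 have "path_eq T n D ?f (p' @ [y]) (m @ [iarr c a b, y])" by simp
      from path_eq_trans[OF path_eq_trans[OF this 2] 3] show ?thesis .
    qed
    show ?thesis
    proof (cases "x = y")
      case True
      have "path_eq T n D ?f p' q'"
        by (rule less.hyps[OF _ p'(1) q'(1) p'(2)])
          (use height[OF p'(3,4), of "wt p'"] q'(2) less.prems(5) True in \<open>simp_all add: p q\<close>)
      then show ?thesis unfolding p q True
        by (rule path_eq_append_right[OF _ p'(2) _ single[OF p'(3)]]) (use q'(2) True in simp)
    next
      case False
      have "min_wt i (asrc x) + arrow_wt x \<le> wt p + col_shift i" "min_wt i (asrc y) + arrow_wt y \<le> wt p + col_shift i"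
        using min_wt_le_wt[OF q'(1) i] min_wt_le_wt[OF p'(1) i] q'(2) p'(2) less.prems(5) by (simp_all add: p q)
      from relation_at_common_target[OF q'(3) p'(3) False q'(4) p'(4) i this]
      obtain a b c where s: "incident_diag D a" "triangle a b c" "e = ed a b"
        "turns a x \<and> y = iarr b c a \<or> turns a y \<and> x = iarr b c a"
        "min_wt i (ed a c) + arrow_wt (iarr c a b) + arrow_wt (iarr b c a) \<le> wt p + col_shift i" by blast
      have w: "wt (p' @ [y]) = wt p" "wt (q' @ [x]) = wt p" using less.prems(5) by (simp_all add: p q)
      show ?thesis unfolding p q
        using s(4) step[OF p' q' w s(1-3) _ _ s(5)] path_eq_sym[OF step[OF q' p' w(2,1) s(1-3) _ _ s(5)]] by blast
    qed
  qed
qed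

end

section \<open>The isomorphisms\<close>

lemma corner_KQ: "f \<in> corner n D A B \<Longrightarrow> f \<in> KQ n D"
  by (simp add: corner_iff)

lemma corner_add:
  assumes f: "f \<in> corner n D A B" and g: "g \<in> corner n D A B"
  shows "kq_add f g \<in> corner n D A B"
proof -
  have "fst p \<in> A \<and> ptgt p \<in> B" if "f p + g p \<noteq> 0" for p
  proof -
    have "f p \<noteq> 0 \<or> g p \<noteq> 0" using that by auto
    then show ?thesis using f g unfolding corner_iff by blast
  qed
  then show ?thesis using f g by (simp add: corner_iff kq_add_def KQ_add)
qed

lemma corner_diff:
  assumes f: "f \<in> corner n D A B" and g: "g \<in> corner n D A B"
  shows "kq_diff f g \<in> corner n D A B"
proof -
  have "fst p \<in> A \<and> ptgt p \<in> B" if "f p - g p \<noteq> 0" for p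
  proof -
    have "f p \<noteq> 0 \<or> g p \<noteq> 0" using that by auto
    then show ?thesis using f g unfolding corner_iff by blast
  qed
  then show ?thesis using f g by (simp add: corner_iff kq_diff_def KQ_diff)
qed

lemma corner_mult:
  assumes "f \<in> corner n D A B" "g \<in> corner n D B C" shows "kq_mult f g \<in> corner n D A C"
proof -
  have "fst p \<in> A \<and> ptgt p \<in> C" if "kq_mult f g p \<noteq> 0" for p
    using that
  proof (rule kq_mult_nonzeroD)
    fix as bs assume *: "snd p = as @ bs" "f (fst p, as) \<noteq> 0" "g (pend (fst p) as, bs) \<noteq> 0"
    have "fst (fst p, as) \<in> A" using *(2) assms(1) unfolding corner_iff by blast
    moreover have "ptgt (pend (fst p) as, bs) \<in> C" using *(3) assms(2) unfolding corner_iff by blast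
    ultimately show "fst p \<in> A \<and> ptgt p \<in> C" using *(1) by simp
  qed
  with assms show ?thesis by (simp add: corner_iff KQ_mult)
qed

lemma wt_poly_corner_zero:
  assumes "f \<in> corner n D A B" "d \<notin> A \<or> e \<notin> B" shows "wt_poly d e f = 0"
proof -
  have "{p. f p \<noteq> 0 \<and> fst p = d \<and> ptgt p = e} = {}" using assms unfolding corner_iff by blast
  then show ?thesis unfolding wt_poly_def by (metis sum.empty)
qed

context triangulated_polygon
begin

section \<open>The action of polynomials through minimal cycles\<close>

lemma tgt_in_edges: "x \<in> arrows n D \<Longrightarrow> atgt x \<in> edges n D"
  using arrow_in_edges by blast

lemma Cel_KQ: "(Cel n D :: path \<Rightarrow> 'a::field) \<in> KQ n D"
  unfolding Cel_def by (intro KQ_sum KQ_basis Cpath_props)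

lemma wt_poly_Cel:
  "wt_poly d e (Cel n D :: path \<Rightarrow> 'a::field) = (if d = e \<and> d \<in> edges n D then monom 1 1 else 0)"
proof -
  have "wt_poly d e (Cel n D :: path \<Rightarrow> 'a) = (\<Sum>v\<in>edges n D. wt_poly d e (kq_basis (Cpath n D v) :: path \<Rightarrow> 'a))"
    unfolding Cel_def by (rule wt_poly_sum[of _ _ n D]) (intro KQ_basis Cpath_props)
  also have "\<dots> = (\<Sum>v\<in>edges n D. if v = d then (if d = e then monom 1 1 else 0) else 0)"
  proof (rule sum.cong[OF refl])
    fix v assume v: "v \<in> edges n D"
    have "pend v (snd (Cpath n D v)) = v" using Cpath_props(2,3)[OF v] by metis
    then show "wt_poly d e (kq_basis (Cpath n D v) :: path \<Rightarrow> 'a) = (if v = d then (if d = e then monom 1 1 else 0) else 0)"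
      using Cpath_props(2,4)[OF v] by (auto simp: wt_poly_basis)
  qed
  also have "\<dots> = (if d = e \<and> d \<in> edges n D then monom 1 1 else 0)" using finite_edges by simp
  finally show ?thesis .
qed

lemma Cel_loops: "Cel n D p \<noteq> (0::'a::field) \<Longrightarrow> ptgt p = fst p"
proof -
  assume "Cel n D p \<noteq> (0::'a)"
  then obtain v where "v \<in> edges n D" "kq_basis (Cpath n D v) p \<noteq> (0::'a)"
    unfolding Cel_def by (metis (no_types, lifting) sum.neutral)
  then show ?thesis using Cpath_props(2,3)[of v] by (auto simp: kq_basis_def split: if_splits)
qed

lemma kq_pow_Cel:
  "(kq_pow n D (Cel n D) k :: path \<Rightarrow> 'a::field) \<in> KQ n D"
  "wt_poly d e (kq_pow n D (Cel n D) k :: path \<Rightarrow> 'a) = (if d = e \<and> d \<in> edges n D then monom 1 k else 0)"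
  "kq_pow n D (Cel n D) k p \<noteq> (0::'a) \<Longrightarrow> ptgt p = fst p"
proof -
  have *: "(kq_pow n D (Cel n D) k :: path \<Rightarrow> 'a) \<in> KQ n D \<and>
    wt_poly d e (kq_pow n D (Cel n D) k :: path \<Rightarrow> 'a) = (if d = e \<and> d \<in> edges n D then monom 1 k else 0) \<and>
    (kq_pow n D (Cel n D) k p \<noteq> (0::'a) \<longrightarrow> ptgt p = fst p)" for d e p
  proof (induction k arbitrary: d e p)
    case 0
    show ?case
      by (auto simp: KQ_idem finite_edges wt_poly_idem) (auto simp: idem_def split: if_splits)
  next
    case (Suc k)
    have K: "(kq_pow n D (Cel n D) k :: path \<Rightarrow> 'a) \<in> KQ n D" using Suc by blast
    have "wt_poly d e (kq_pow n D (Cel n D) (Suc k) :: path \<Rightarrow> 'a) =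
        (\<Sum>c\<in>edges n D. wt_poly d c (Cel n D :: path \<Rightarrow> 'a) * wt_poly c e (kq_pow n D (Cel n D) k :: path \<Rightarrow> 'a))"
      unfolding kq_pow.simps by (rule wt_poly_mult[OF Cel_KQ K finite_edges tgt_in_edges])
    also have "\<dots> = (\<Sum>c\<in>edges n D. if c = d then (if d = e then monom 1 (Suc k) else 0) else 0)"
      by (rule sum.cong) (auto simp: Suc wt_poly_Cel mult_monom)
    also have "\<dots> = (if d = e \<and> d \<in> edges n D then monom 1 (Suc k) else 0)" using finite_edges by simp
    finally have wp: "wt_poly d e (kq_pow n D (Cel n D) (Suc k) :: path \<Rightarrow> 'a) = \<dots>" .
    have "ptgt p = fst p" if nz: "kq_mult (Cel n D) (kq_pow n D (Cel n D) k) p \<noteq> (0::'a)"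
      using nz
    proof (rule kq_mult_nonzeroD)
      fix as bs assume *: "snd p = as @ bs" "Cel n D (fst p, as) \<noteq> (0::'a)"
        "kq_pow n D (Cel n D) k (pend (fst p) as, bs) \<noteq> (0::'a)"
      have "pend (fst p) as = fst p" using Cel_loops[OF *(2)] by simp
      moreover have "ptgt (pend (fst p) as, bs) = fst (pend (fst p) as, bs)" using *(3) Suc by blast
      ultimately show ?thesis using *(1) by simp
    qed
    then show ?case using wp KQ_mult[OF Cel_KQ K] by simp
  qed
  show "(kq_pow n D (Cel n D) k :: path \<Rightarrow> 'a::field) \<in> KQ n D"
    "wt_poly d e (kq_pow n D (Cel n D) k :: path \<Rightarrow> 'a) = (if d = e \<and> d \<in> edges n D then monom 1 k else 0)"
    "kq_pow n D (Cel n D) k p \<noteq> (0::'a) \<Longrightarrow> ptgt p = fst p"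
    using * by blast+
qed

lemma kq_smul_poly_corner:
  assumes g: "(g :: path \<Rightarrow> 'a::field) \<in> corner n D A B"
  shows "kq_smul_poly n D r g \<in> corner n D A B"
proof -
  have gK: "g \<in> KQ n D" using g by (rule corner_KQ)
  have "kq_smul_poly n D r g \<in> KQ n D"
    unfolding kq_smul_poly_def by (intro KQ_sum KQ_smult KQ_mult kq_pow_Cel gK)
  moreover have "fst p \<in> A \<and> ptgt p \<in> B" if nz: "kq_smul_poly n D r g p \<noteq> 0" for p
  proof -
    obtain k where "kq_mult (kq_pow n D (Cel n D) k) g p \<noteq> 0"
      using nz unfolding kq_smul_poly_def by (metis (no_types, lifting) sum.neutral mult_zero_right)
    then show ?thesis
    proof (rule kq_mult_nonzeroD)
      fix as bs assume *: "snd p = as @ bs" "kq_pow n D (Cel n D) k (fst p, as) \<noteq> (0::'a)"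
        "g (pend (fst p) as, bs) \<noteq> 0"
      have "pend (fst p) as = fst p" using kq_pow_Cel(3)[OF *(2)] by simp
      moreover have "fst (pend (fst p) as, bs) \<in> A \<and> ptgt (pend (fst p) as, bs) \<in> B"
        using *(3) g unfolding corner_iff by blast
      ultimately show ?thesis using *(1) by simp
    qed
  qed
  ultimately show ?thesis by (simp add: corner_iff)
qed

text \<open>The chosen cycles all have weight 1, so the \<open>k\<close>-th power of
  \<open>Cel n D\<close> has the scalar matrix with diagonal entry \<open>monom 1 k\<close>.\<close>

lemma wt_poly_kq_smul_poly:
  assumes g: "(g :: path \<Rightarrow> 'a::field) \<in> KQ n D" and d: "d \<in> edges n D"
  shows "wt_poly d e (kq_smul_poly n D r g) = r * wt_poly d e g"
proof -
  have m: "wt_poly d e (kq_mult (kq_pow n D (Cel n D) k) g) = monom 1 k * wt_poly d e g" for k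
  proof -
    have "wt_poly d e (kq_mult (kq_pow n D (Cel n D) k) g) =
        (\<Sum>c\<in>edges n D. wt_poly d c (kq_pow n D (Cel n D) k :: path \<Rightarrow> 'a) * wt_poly c e g)"
      by (rule wt_poly_mult[OF kq_pow_Cel(1) g finite_edges tgt_in_edges])
    also have "\<dots> = (\<Sum>c\<in>edges n D. if c = d then monom 1 k * wt_poly d e g else 0)"
      by (rule sum.cong) (auto simp: kq_pow_Cel(2))
    finally show ?thesis using d finite_edges by simp
  qed
  have K: "kq_mult (kq_pow n D (Cel n D) k) g \<in> KQ n D" for k by (intro KQ_mult kq_pow_Cel g)
  have "wt_poly d e (kq_smul_poly n D r g) = (\<Sum>k\<le>degree r. smult (coeff r k) (monom 1 k * wt_poly d e g))"
    unfolding kq_smul_poly_def by (subst wt_poly_sum[of _ _ n D]) (auto intro!: KQ_smult K sum.cong simp: wt_poly_smult[OF K] m)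
  also have "\<dots> = (\<Sum>k\<le>degree r. monom (coeff r k) k) * wt_poly d e g"
    unfolding sum_distrib_right by (rule sum.cong) (simp_all add: smult_monom flip: mult_smult_left)
  finally show ?thesis by (simp add: poly_as_sum_of_monoms)
qed

section \<open>Weights as a complete invariant of the corners\<close>

lemma frozen_eq: "frozen n = next_side n ` {1..n}"
proof
  show "frozen n \<subseteq> next_side n ` {1..n}"
  proof
    fix e assume "e \<in> frozen n"
    then obtain a where "1 \<le> a" "a \<le> n" "e = next_side n a" using side_cases unfolding frozen_def by blast
    then show "e \<in> next_side n ` {1..n}" by simp
  qed
qed (auto simp: frozen_def next_side_is_side)

lemma inj_next_side: "inj_on (next_side n) {1..n}"
  using next_side_inj by (auto simp: inj_on_def)

lemma frozen_subset: "frozen n \<subseteq> edges n D"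
  using side_in_edges by (auto simp: frozen_def)

lemma finite_frozen: "finite (frozen n)"
  using finite_subset[OF frozen_subset finite_edges] .

lemma wt_poly_corner_mult:
  assumes f: "(f :: path \<Rightarrow> 'a::field) \<in> corner n D A (frozen n)" and g: "g \<in> KQ n D"
  shows "wt_poly d e (kq_mult f g) = (\<Sum>k\<in>{1..n}. wt_poly d (next_side n k) f * wt_poly (next_side n k) e g)"
proof -
  have "wt_poly d e (kq_mult f g) = (\<Sum>c\<in>edges n D. wt_poly d c f * wt_poly c e g)"
    by (rule wt_poly_mult[OF corner_KQ[OF f] g finite_edges tgt_in_edges])
  also have "\<dots> = (\<Sum>c\<in>frozen n. wt_poly d c f * wt_poly c e g)"
    by (rule sum.mono_neutral_right[OF finite_edges frozen_subset]) (use wt_poly_corner_zero[OF f] in auto)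
  also have "\<dots> = (\<Sum>k\<in>{1..n}. wt_poly d (next_side n k) f * wt_poly (next_side n k) e g)"
    unfolding frozen_eq by (rule sum.reindex_cong[OF inj_next_side]) auto
  finally show ?thesis .
qed

text \<open>One direction is \<open>Jideal_subset_kernel\<close>. The other rests on the congruence
  of paths of equal weight, available because paths in the corner start at a side.\<close>

lemma gam_eq_corner_iff:
  assumes f: "(f :: path \<Rightarrow> 'a::field) \<in> corner n D (frozen n) B" and g: "g \<in> corner n D (frozen n) B"
  shows "gam_eq n D f g \<longleftrightarrow> (\<forall>i\<in>{1..n}. \<forall>e\<in>B. wt_poly (next_side n i) e f = wt_poly (next_side n i) e g)"
proof
  have diff: "wt_poly d e (kq_diff f g) = wt_poly d e f - wt_poly d e g" for d e
    unfolding kq_diff_def using corner_KQ[OF f] corner_KQ[OF g] by (rule wt_poly_diff)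
  {
    assume "gam_eq n D f g"
    then have "kq_diff f g \<in> Jideal n D" by (simp add: gam_eq_def)
    then have "wt_poly d e (kq_diff f g) = 0" for d e by (rule Jideal_subset_kernel(2))
    then show "\<forall>i\<in>{1..n}. \<forall>e\<in>B. wt_poly (next_side n i) e f = wt_poly (next_side n i) e g"
      unfolding diff by simp
  next
    assume *: "\<forall>i\<in>{1..n}. \<forall>e\<in>B. wt_poly (next_side n i) e f = wt_poly (next_side n i) e g"
    note h = corner_diff[OF f g]
    have z: "wt_poly d e (kq_diff f g) = 0" for d e
    proof (cases "d \<in> frozen n \<and> e \<in> B")
      case True
      then show ?thesis using * unfolding diff frozen_eq by auto
    next
      case False
      then show ?thesis using wt_poly_corner_zero[OF h] by blast
    qed
    have "kq_diff f g \<in> Jideal n D"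
    proof (rule in_Jideal_of_wt_poly_zero[OF corner_KQ[OF h] _ z])
      show "fst p \<in> frozen n" if "kq_diff f g p \<noteq> 0" for p using that h unfolding corner_iff by blast
      show "path_eq TYPE('a) n D (fst p) (snd p) (snd q)"
        if pq: "is_path n D p" "is_path n D q" "fst p \<in> frozen n" "fst q = fst p" "ptgt p = ptgt q" "wt (snd p) = wt (snd q)"
        for p q
      proof -
        obtain i where i: "1 \<le> i" "i \<le> n" "fst p = next_side n i" using pq(3) unfolding frozen_eq by auto
        have "p = (next_side n i, snd p)" "q = (next_side n i, snd q)"
          using i(3) pq(4) by (metis prod.collapse)+
        then show ?thesis
          using path_eq_of_wt_eq[of i "snd p" "snd q" "ptgt p" "TYPE('a)"] pq i by (metis fst_conv snd_conv)
      qed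
    qed
    then show "gam_eq n D f g" by (simp add: gam_eq_def)
  }
qed

text \<open>No path in \<open>f\<close> is lighter than \<open>min_wt_le_wt\<close> permits. The
  shift stays on the right as a factor, which avoids a truncated difference of exponents.\<close>

lemma corner_dvd:
  assumes f: "(f :: path \<Rightarrow> 'a::field) \<in> KQ n D" and i: "i \<in> {1..n}"
  shows "monom 1 (min_wt i e) dvd monom 1 (col_shift i) * wt_poly (next_side n i) e f"
  unfolding monom_1_dvd_iff' coeff_monom_mult
proof (intro allI impI)
  fix k assume k: "k < min_wt i e"
  have "coeff (wt_poly (next_side n i) e f) (k - col_shift i) = 0" if "col_shift i \<le> k"
  proof -
    have "{p. f p \<noteq> 0 \<and> fst p = next_side n i \<and> ptgt p = e \<and> wt (snd p) = k - col_shift i} = {}"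
    proof (rule ccontr)
      assume "\<not> ?thesis"
      then obtain p where p: "f p \<noteq> 0" "fst p = next_side n i" "ptgt p = e" "wt (snd p) = k - col_shift i" by blast
      have "is_path n D p" using p(1) f by (simp add: KQ_def)
      then have "is_path n D (next_side n i, snd p)" using p(2) by (metis prod.collapse)
      from min_wt_le_wt[OF this] i p k that show False by simp
    qed
    then show ?thesis unfolding coeff_wt_poly[OF KQ_finite[OF f]] by (metis sum.empty)
  qed
  then show "(if k < col_shift i then 0 else 1 * coeff (wt_poly (next_side n i) e f) (k - col_shift i)) = 0" by simp
qed

text \<open>For each monomial of a prescribed entry, \<open>path_exists\<close> supplies a path of
  that weight; \<open>g\<close> is the combination of these paths with the prescribed
  coefficients.\<close>

lemma corner_with_entries:
  assumes B: "B \<subseteq> edges n D"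
  obtains g where "(g :: path \<Rightarrow> 'a::field) \<in> corner n D (frozen n) B"
    "\<And>i e. i \<in> {1..n} \<Longrightarrow> e \<in> B \<Longrightarrow> monom 1 (col_shift i) * wt_poly (next_side n i) e g = monom 1 (min_wt i e) * q i e"
proof -
  \<comment> \<open>The subtraction is exact, since \<open>col_shift i\<close> is at most
    \<open>min_wt i e\<close> for edges.\<close>
  define Q where "Q i e = monom 1 (min_wt i e - col_shift i) * q i e" for i e
  define m where "m i e k = (SOME as. is_path n D (next_side n i, as) \<and> pend (next_side n i) as = e \<and> wt as = k)" for i e k
  define h where "h i e k p = coeff (Q i e) k * kq_basis (next_side n i, m i e k) p" for i e k p
  define g where "g p = (\<Sum>i\<in>{1..n}. \<Sum>e\<in>B. \<Sum>k\<le>degree (Q i e). h i e k p)" for p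
  have fB: "finite B" using finite_subset[OF B finite_edges] .
  have m: "is_path n D (next_side n i, m i e k)" "pend (next_side n i) (m i e k) = e" "wt (m i e k) = k"
    if "i \<in> {1..n}" "e \<in> B" "coeff (Q i e) k \<noteq> 0" for i e k
  proof -
    have e: "e \<in> edges n D" using B that by blast
    have "\<not> k < min_wt i e - col_shift i" using that(3) unfolding Q_def coeff_monom_mult by (auto split: if_splits)
    then have "min_wt i e \<le> k + col_shift i" by linarith
    with path_exists[OF e _ _ this] that(1)
    have "\<exists>as. is_path n D (next_side n i, as) \<and> pend (next_side n i) as = e \<and> wt as = k" by auto
    from someI_ex[OF this]
    show "is_path n D (next_side n i, m i e k)" "pend (next_side n i) (m i e k) = e" "wt (m i e k) = k"
      unfolding m_def by blast+
  qed
  have hK: "h i e k \<in> KQ n D" if "i \<in> {1..n}" "e \<in> B" for i e k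
  proof (cases "coeff (Q i e) k = 0")
    case True
    then show ?thesis using KQ_zero by (simp add: h_def[abs_def])
  next
    case False
    then show ?thesis unfolding h_def[abs_def] using m that by (intro KQ_smult KQ_basis) blast
  qed
  have hw: "wt_poly d e' (h i e k) = (if next_side n i = d \<and> e = e' then monom (coeff (Q i e) k) k else 0)"
    if "i \<in> {1..n}" "e \<in> B" for i e k d e'
  proof (cases "coeff (Q i e) k = 0")
    case True
    then show ?thesis by (auto simp: h_def[abs_def] wt_poly_zero)
  next
    case False
    note mm = m[OF that False]
    show ?thesis unfolding h_def[abs_def] wt_poly_smult[OF KQ_basis[OF mm(1)]] wt_poly_basis
      using mm by (auto simp: smult_monom)
  qed
  have gK: "g \<in> KQ n D" unfolding g_def[abs_def] by (intro KQ_sum hK)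
  have "fst p \<in> frozen n \<and> ptgt p \<in> B" if "g p \<noteq> 0" for p
  proof -
    obtain i where i: "i \<in> {1..n}" "(\<Sum>e\<in>B. \<Sum>k\<le>degree (Q i e). h i e k p) \<noteq> 0"
      using \<open>g p \<noteq> 0\<close> unfolding g_def by (metis (no_types, lifting) sum.neutral)
    then obtain e where e: "e \<in> B" "(\<Sum>k\<le>degree (Q i e). h i e k p) \<noteq> 0"
      by (metis (no_types, lifting) sum.neutral)
    then obtain k where k: "h i e k p \<noteq> 0" by (metis (no_types, lifting) sum.neutral)
    then have "coeff (Q i e) k \<noteq> 0" "p = (next_side n i, m i e k)"
      by (auto simp: h_def kq_basis_def split: if_splits)
    with m(2)[OF i(1) e(1)] e(1) i(1) show ?thesis by (simp add: frozen_eq)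
  qed
  with gK have gc: "g \<in> corner n D (frozen n) B" by (simp add: corner_iff)
  have wg: "wt_poly (next_side n i) e g = Q i e" if ie: "i \<in> {1..n}" "e \<in> B" for i e
  proof -
    have "wt_poly (next_side n i) e g =
        (\<Sum>i'\<in>{1..n}. \<Sum>e'\<in>B. \<Sum>k\<le>degree (Q i' e'). wt_poly (next_side n i) e (h i' e' k))"
      unfolding g_def[abs_def]
      by (subst wt_poly_sum[of _ _ n D], intro KQ_sum hK, assumption+, rule sum.cong, rule refl,
          subst wt_poly_sum[of _ _ n D], intro KQ_sum hK, assumption+, rule sum.cong, rule refl,
          rule wt_poly_sum[of _ _ n D], intro hK)
    also have "\<dots> = (\<Sum>i'\<in>{1..n}. \<Sum>e'\<in>B. if i' = i \<and> e' = e then Q i e else 0)"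
    proof (intro sum.cong refl)
      fix i' e' assume *: "i' \<in> {1..n}" "e' \<in> B"
      have "next_side n i' = next_side n i \<longleftrightarrow> i' = i"
        using inj_on_eq_iff[OF inj_next_side] *(1) ie(1) by blast
      then show "(\<Sum>k\<le>degree (Q i' e'). wt_poly (next_side n i) e (h i' e' k)) = (if i' = i \<and> e' = e then Q i e else 0)"
        by (auto simp: hw[OF *] poly_as_sum_of_monoms)
    qed
    also have "\<dots> = (\<Sum>i'\<in>{1..n}. if i' = i then Q i e else 0)"
      by (rule sum.cong) (use ie fB in auto)
    finally show ?thesis using ie by simp
  qed
  show ?thesis
  proof (rule that[OF gc])
    fix i e assume ie: "i \<in> {1..n}" "e \<in> B"
    have "col_shift i \<le> min_wt i e" using col_shift_le_min_wt B ie by blast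
    then show "monom 1 (col_shift i) * wt_poly (next_side n i) e g = monom 1 (min_wt i e) * q i e"
      unfolding wg[OF ie] Q_def by (simp add: mult_monom flip: mult.assoc)
  qed
qed

section \<open>Matrices and vectors of path algebra elements\<close>

definition entry :: "nat \<Rightarrow> edge \<Rightarrow> (path \<Rightarrow> 'a::field) \<Rightarrow> 'a poly fract" where
  "entry i e f = to_fract (monom 1 (col_shift i)) * to_fract (wt_poly (next_side n i) e f)"

text \<open>Conjugates the weight matrix by the diagonal matrix with entries 1, ..., 1, x, which
  produces the exponent \<open>-1\<close> of \<open>c_exp\<close>.\<close>

definition mat :: "(path \<Rightarrow> 'a::field) \<Rightarrow> nat \<Rightarrow> nat \<Rightarrow> 'a poly fract" where
  "mat f = (\<lambda>i j. if i \<in> {1..n} \<and> j \<in> {1..n} then entry i (next_side n j) f / to_fract (monom 1 (col_shift j)) else 0)"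

text \<open>Only the rows are rescaled: multiplication by \<open>mat f\<close> divides by the row
  factors of the vector again.\<close>

definition vec :: "edge \<Rightarrow> (path \<Rightarrow> 'a::field) \<Rightarrow> nat \<Rightarrow> 'a poly fract" where
  "vec e f = (\<lambda>i. if i \<in> {1..n} then entry i e f else 0)"

lemma to_fract_monom_neq_0: "to_fract (monom 1 k :: 'a::field poly) \<noteq> 0"
  by (simp add: monom_eq_0_iff)

lemma entry_eq_iff: "entry i e f = entry i e g \<longleftrightarrow> wt_poly (next_side n i) e f = wt_poly (next_side n i) e g"
  by (simp add: entry_def monom_eq_0_iff)

lemma xR_nonneg: "0 \<le> k \<Longrightarrow> z \<in> xR k \<longleftrightarrow> (\<exists>q. z = to_fract (monom 1 (nat k) * q))"
  unfolding xR_def by (auto simp: to_fract_def[symmetric] simp del: to_fract_mult simp flip: to_fract_mult simp: mult.commute)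

lemma stmod_entry_iff:
  "z \<in> xR (if i \<le> s then 0 else if i \<le> t then 1 else 2) \<longleftrightarrow> (\<exists>q. z = to_fract (monom 1 (min_wt i (s,t)) * q))"
  by (subst xR_nonneg) (auto simp: min_wt_def)

text \<open>Column \<open>j\<close> of the order is the module of side \<open>j\<close>, except that
  column \<open>n\<close> is divided by x. The cases are the ordinary columns, the entry with
  exponent \<open>-1\<close>, and the rest of column \<open>n\<close>.\<close>

lemma Lambda_entry_iff:
  assumes "i \<in> {1..n}" "j \<in> {1..n}"
  shows "z \<in> xR (c_exp n i j) \<longleftrightarrow>
    (\<exists>q. z = to_fract (monom 1 (min_wt i (next_side n j)) * q) / to_fract (monom 1 (col_shift j)))"
proof -
  consider "j < n" | "j = n" "i = 1" | "j = n" "i \<noteq> 1" using assms by fastforce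
  then show ?thesis
  proof cases
    case 1
    then have "c_exp n i j = int (min_wt i (next_side n j))" "col_shift j = 0"
      by (auto simp: c_exp_def min_wt_def next_side_def col_shift_def)
    then show ?thesis by (simp add: xR_nonneg)
  next
    case 2
    then have "c_exp n i j = -1" "col_shift j = 1" "min_wt i (next_side n j) = 0"
      using n3 by (auto simp: c_exp_def min_wt_def next_side_def col_shift_def)
    then show ?thesis
      unfolding xR_def by (simp add: to_fract_def[symmetric] divide_inverse)
  next
    case 3
    then have "c_exp n i j = 0" "col_shift j = 1" "min_wt i (next_side n j) = 1"
      using n3 assms by (auto simp: c_exp_def min_wt_def next_side_def col_shift_def)
    then show ?thesis using to_fract_monom_neq_0[of 1, where 'a='a] by (simp add: xR_nonneg)
  qed
qed

lemma mat_in_Lambda: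
  assumes "(f :: path \<Rightarrow> 'a::field) \<in> KQ n D" shows "mat f \<in> Lambda n"
  unfolding Lambda_def
proof (intro CollectI conjI allI impI ballI)
  fix i j assume ij: "i \<in> {1..n}" "j \<in> {1..n}"
  obtain q where "monom 1 (col_shift i) * wt_poly (next_side n i) (next_side n j) f = monom 1 (min_wt i (next_side n j)) * q"
    using corner_dvd[OF assms ij(1), of "next_side n j"] unfolding dvd_def by blast
  then have "entry i (next_side n j) f = to_fract (monom 1 (min_wt i (next_side n j)) * q)"
    unfolding entry_def to_fract_mult[symmetric] by simp
  then show "mat f i j \<in> xR (c_exp n i j)" unfolding Lambda_entry_iff[OF ij] mat_def using ij by auto
qed (auto simp: mat_def split: if_splits)

lemma vec_in_stmod:
  assumes "(f :: path \<Rightarrow> 'a::field) \<in> KQ n D" shows "vec (s,t) f \<in> stmod n s t"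
  unfolding stmod_def
proof (intro CollectI conjI allI impI ballI)
  fix i assume i: "i \<in> {1..n}"
  obtain q where "monom 1 (col_shift i) * wt_poly (next_side n i) (s,t) f = monom 1 (min_wt i (s,t)) * q"
    using corner_dvd[OF assms i, of "(s,t)"] unfolding dvd_def by blast
  then have "entry i (s,t) f = to_fract (monom 1 (min_wt i (s,t)) * q)"
    unfolding entry_def to_fract_mult[symmetric] by simp
  then show "vec (s,t) f i \<in> xR (if i \<le> s then 0 else if i \<le> t then 1 else 2)"
    unfolding stmod_entry_iff vec_def using i by auto
qed (auto simp: vec_def split: if_splits)

lemma mat_surj:
  assumes L: "L \<in> Lambda n"
  obtains g where "(g :: path \<Rightarrow> 'a::field) \<in> corner n D (frozen n) (frozen n)" "mat g = L"
proof -
  have "\<forall>i j. \<exists>q. i \<in> {1..n} \<and> j \<in> {1..n} \<longrightarrow>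
      L i j = to_fract (monom 1 (min_wt i (next_side n j)) * q) / to_fract (monom 1 (col_shift j))"
    using L Lambda_entry_iff unfolding Lambda_def by blast
  then obtain q where q: "\<And>i j. i \<in> {1..n} \<Longrightarrow> j \<in> {1..n} \<Longrightarrow>
      L i j = to_fract (monom 1 (min_wt i (next_side n j)) * q i j) / to_fract (monom 1 (col_shift j))" by metis
  obtain g where g: "(g :: path \<Rightarrow> 'a) \<in> corner n D (frozen n) (frozen n)"
    "\<And>i e. i \<in> {1..n} \<Longrightarrow> e \<in> frozen n \<Longrightarrow> monom 1 (col_shift i) * wt_poly (next_side n i) e g =
        monom 1 (min_wt i e) * q i (inv_into {1..n} (next_side n) e)"
    using corner_with_entries[OF frozen_subset, of "\<lambda>i e. q i (inv_into {1..n} (next_side n) e)"] by blast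
  have "mat g i j = L i j" for i j
  proof (cases "i \<in> {1..n} \<and> j \<in> {1..n}")
    case True
    then have "entry i (next_side n j) g = to_fract (monom 1 (min_wt i (next_side n j)) * q i j)"
      using g(2)[of i "next_side n j"] inv_into_f_f[OF inj_next_side, of j]
      unfolding entry_def to_fract_mult[symmetric] by (simp add: frozen_eq)
    then show ?thesis using True q[of i j] by (simp add: mat_def)
  next
    case False
    then show ?thesis using L by (auto simp: mat_def Lambda_def)
  qed
  then have "mat g = L" by blast
  with g that show ?thesis by blast
qed

lemma vec_surj:
  assumes v: "v \<in> stmod n s t" and e: "(s,t) \<in> edges n D"
  obtains g where "(g :: path \<Rightarrow> 'a::field) \<in> corner n D (frozen n) {(s,t)}" "vec (s,t) g = v"
proof -
  have "\<forall>i. \<exists>q. i \<in> {1..n} \<longrightarrow> v i = to_fract (monom 1 (min_wt i (s,t)) * q)"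
    using v stmod_entry_iff unfolding stmod_def by blast
  then obtain q where q: "\<And>i. i \<in> {1..n} \<Longrightarrow> v i = to_fract (monom 1 (min_wt i (s,t)) * q i)" by metis
  obtain g where g: "(g :: path \<Rightarrow> 'a) \<in> corner n D (frozen n) {(s,t)}"
    "\<And>i e. i \<in> {1..n} \<Longrightarrow> e \<in> {(s,t)} \<Longrightarrow> monom 1 (col_shift i) * wt_poly (next_side n i) e g = monom 1 (min_wt i e) * q i"
    using corner_with_entries[of "{(s,t)}" "\<lambda>i e. q i"] e by blast
  have "vec (s,t) g i = v i" for i
  proof (cases "i \<in> {1..n}")
    case True
    then show ?thesis using g(2)[of i "(s,t)"] q[of i]
      unfolding vec_def entry_def to_fract_mult[symmetric] by simp
  next
    case False
    then show ?thesis using v by (auto simp: vec_def stmod_def)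
  qed
  then have "vec (s,t) g = v" by blast
  with g that show ?thesis by blast
qed

lemma gam_eq_iff_mat:
  assumes "(f :: path \<Rightarrow> 'a::field) \<in> corner n D (frozen n) (frozen n)" "g \<in> corner n D (frozen n) (frozen n)"
  shows "gam_eq n D f g \<longleftrightarrow> mat f = mat g"
proof -
  have "mat f = mat g \<longleftrightarrow> (\<forall>i\<in>{1..n}. \<forall>j\<in>{1..n}. entry i (next_side n j) f = entry i (next_side n j) g)"
    unfolding mat_def fun_eq_iff using to_fract_monom_neq_0[where 'a='a] by auto
  then show ?thesis unfolding gam_eq_corner_iff[OF assms] entry_eq_iff by (simp add: frozen_eq)
qed

lemma gam_eq_iff_vec:
  assumes "(f :: path \<Rightarrow> 'a::field) \<in> corner n D (frozen n) {e}" "g \<in> corner n D (frozen n) {e}"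
  shows "gam_eq n D f g \<longleftrightarrow> vec e f = vec e g"
proof -
  have "vec e f = vec e g \<longleftrightarrow> (\<forall>i\<in>{1..n}. entry i e f = entry i e g)"
    unfolding vec_def fun_eq_iff by auto
  then show ?thesis unfolding gam_eq_corner_iff[OF assms] entry_eq_iff by simp
qed

lemma entry_add: "f \<in> KQ n D \<Longrightarrow> g \<in> KQ n D \<Longrightarrow> entry i e (kq_add f g) = entry i e f + entry i e g"
  unfolding entry_def kq_add_def by (simp add: wt_poly_add distrib_left)

text \<open>The factor dividing column \<open>k\<close> of \<open>mat f\<close> is the one
  multiplying row \<open>k\<close> of \<open>g\<close>, so the two cancel.\<close>

lemma entry_mult:
  assumes f: "(f :: path \<Rightarrow> 'a::field) \<in> corner n D (frozen n) (frozen n)" and g: "g \<in> KQ n D" and i: "i \<in> {1..n}"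
  shows "entry i e (kq_mult f g) = (\<Sum>k\<in>{1..n}. mat f i k * entry k e g)"
proof -
  have to_fract_sum: "to_fract (sum h A) = (\<Sum>x\<in>A. to_fract (h x))" for h :: "nat \<Rightarrow> 'a poly" and A
    by (induction A rule: infinite_finite_induct) auto
  have "entry i e (kq_mult f g) =
      (\<Sum>k\<in>{1..n}. to_fract (monom 1 (col_shift i)) * (to_fract (wt_poly (next_side n i) (next_side n k) f) * to_fract (wt_poly (next_side n k) e g)))"
    unfolding entry_def wt_poly_corner_mult[OF f g] to_fract_sum by (simp add: sum_distrib_left)
  also have "\<dots> = (\<Sum>k\<in>{1..n}. mat f i k * entry k e g)"
  proof (rule sum.cong)
    fix k assume "k \<in> {1..n}"
    then show "to_fract (monom 1 (col_shift i)) * (to_fract (wt_poly (next_side n i) (next_side n k) f) * to_fract (wt_poly (next_side n k) e g)) =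
        mat f i k * entry k e g"
      using i to_fract_monom_neq_0[of "col_shift k", where 'a='a] by (simp add: mat_def entry_def)
  qed simp
  finally show ?thesis .
qed

lemma mat_add: "f \<in> KQ n D \<Longrightarrow> g \<in> KQ n D \<Longrightarrow> mat (kq_add f g) = madd (mat f) (mat g)"
  unfolding mat_def madd_def fun_eq_iff by (simp add: entry_add add_divide_distrib)

lemma vec_add: "f \<in> KQ n D \<Longrightarrow> g \<in> KQ n D \<Longrightarrow> vec e (kq_add f g) = vadd (vec e f) (vec e g)"
  unfolding vec_def vadd_def fun_eq_iff by (simp add: entry_add)

lemma mat_mult:
  assumes "(f :: path \<Rightarrow> 'a::field) \<in> corner n D (frozen n) (frozen n)" "g \<in> KQ n D"
  shows "mat (kq_mult f g) = mmult n (mat f) (mat g)"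
proof (intro ext)
  fix i j
  show "mat (kq_mult f g) i j = mmult n (mat f) (mat g) i j"
  proof (cases "i \<in> {1..n} \<and> j \<in> {1..n}")
    case True
    have "mmult n (mat f) (mat g) i j = (\<Sum>k\<in>{1..n}. mat f i k * (entry k (next_side n j) g / to_fract (monom 1 (col_shift j))))"
      unfolding mmult_def by (rule sum.cong) (use True in \<open>auto simp: mat_def\<close>)
    then show ?thesis using True entry_mult[OF assms, of i "next_side n j"]
      by (simp add: mat_def[of "kq_mult f g"] sum_divide_distrib)
  next
    case False
    then show ?thesis by (auto simp: mmult_def mat_def)
  qed
qed

lemma vec_mult:
  assumes "(f :: path \<Rightarrow> 'a::field) \<in> corner n D (frozen n) (frozen n)" "g \<in> KQ n D"
  shows "vec e (kq_mult f g) = mvec n (mat f) (vec e g)"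
proof (intro ext)
  fix i
  show "vec e (kq_mult f g) i = mvec n (mat f) (vec e g) i"
  proof (cases "i \<in> {1..n}")
    case True
    then show ?thesis using entry_mult[OF assms True] by (simp add: vec_def mvec_def)
  next
    case False
    then show ?thesis by (auto simp: mvec_def mat_def vec_def)
  qed
qed

lemma mat_idem: "mat (idem (frozen n) :: path \<Rightarrow> 'a::field) = mone n"
proof (intro ext)
  fix i j
  let ?I = "idem (frozen n) :: path \<Rightarrow> 'a"
  show "mat ?I i j = mone n i j"
  proof (cases "i \<in> {1..n} \<and> j \<in> {1..n}")
    case False
    then have "\<not> (i = j \<and> i \<in> {1..n})" by blast
    with False show ?thesis unfolding mat_def mone_def by (simp only: if_False)
  next
    case True
    then have mem: "next_side n i \<in> frozen n" unfolding frozen_eq by blast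
    show ?thesis
    proof (cases "i = j")
      case eq: True
      have "wt_poly (next_side n i) (next_side n i) ?I = 1"
        unfolding wt_poly_idem[OF finite_frozen] using mem by simp
      then have "entry i (next_side n i) ?I = to_fract (monom 1 (col_shift i))" by (simp add: entry_def)
      then show ?thesis using True to_fract_monom_neq_0[of "col_shift i", where 'a='a] unfolding mat_def mone_def eq[symmetric]
        by simp
    next
      case False
      then have "next_side n i \<noteq> next_side n j" using inj_on_eq_iff[OF inj_next_side] True by blast
      then have "wt_poly (next_side n i) (next_side n j) ?I = 0"
        unfolding wt_poly_idem[OF finite_frozen] by simp
      then have "entry i (next_side n j) ?I = 0" by (simp add: entry_def)
      then show ?thesis using False unfolding mat_def mone_def by simp
    qed
  qed
qed

lemma idem_corner: "(idem (frozen n) :: path \<Rightarrow> 'a::field) \<in> corner n D (frozen n) (frozen n)"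
  unfolding corner_iff using KQ_idem[OF finite_frozen frozen_subset] by (auto simp: idem_def split: if_splits)

lemma mat_smul:
  assumes "(g :: path \<Rightarrow> 'a::field) \<in> KQ n D"
  shows "mat (kq_smul_poly n D r g) = msmul r (mat g)"
proof (intro ext)
  fix i j
  show "mat (kq_smul_poly n D r g) i j = msmul r (mat g) i j"
  proof (cases "i \<in> {1..n}")
    case True
    then have "next_side n i \<in> edges n D" using frozen_subset by (auto simp: frozen_eq)
    then have "wt_poly (next_side n i) (next_side n j) (kq_smul_poly n D r g) =
        r * wt_poly (next_side n i) (next_side n j) g" by (rule wt_poly_kq_smul_poly[OF assms])
    then show ?thesis by (simp add: mat_def msmul_def entry_def to_fract_def[symmetric])
  next
    case False
    then show ?thesis by (auto simp: mat_def msmul_def)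
  qed
qed

text \<open>The natural map sends elements to matrices. In the other direction a preimage is chosen,
  which is determined only modulo the ideal.\<close>

definition phi :: "(nat \<Rightarrow> nat \<Rightarrow> 'a::field poly fract) \<Rightarrow> path \<Rightarrow> 'a" where
  "phi L = (SOME g. g \<in> corner n D (frozen n) (frozen n) \<and> mat g = L)"

definition psi :: "edge \<Rightarrow> (nat \<Rightarrow> 'a::field poly fract) \<Rightarrow> path \<Rightarrow> 'a" where
  "psi e v = (SOME g. g \<in> corner n D (frozen n) {e} \<and> vec e g = v)"

lemma phi:
  assumes "(L :: nat \<Rightarrow> nat \<Rightarrow> 'a::field poly fract) \<in> Lambda n"
  shows "phi L \<in> corner n D (frozen n) (frozen n)" "phi L \<in> KQ n D" "mat (phi L) = L"
proof -
  have "\<exists>g :: path \<Rightarrow> 'a. g \<in> corner n D (frozen n) (frozen n) \<and> mat g = L" using mat_surj[OF assms] by blast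
  from someI_ex[OF this] show "phi L \<in> corner n D (frozen n) (frozen n)" "mat (phi L) = L"
    unfolding phi_def by blast+
  then show "phi L \<in> KQ n D" by (simp add: corner_KQ)
qed

lemma psi:
  assumes "(s,t) \<in> edges n D" "(v :: nat \<Rightarrow> 'a::field poly fract) \<in> stmod n s t"
  shows "psi (s,t) v \<in> corner n D (frozen n) {(s,t)}" "psi (s,t) v \<in> KQ n D" "vec (s,t) (psi (s,t) v) = v"
proof -
  have "\<exists>g :: path \<Rightarrow> 'a. g \<in> corner n D (frozen n) {(s,t)} \<and> vec (s,t) g = v" using vec_surj[OF assms(2,1)] by blast
  from someI_ex[OF this] show "psi (s,t) v \<in> corner n D (frozen n) {(s,t)}" "vec (s,t) (psi (s,t) v) = v"
    unfolding psi_def by blast+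
  then show "psi (s,t) v \<in> KQ n D" by (simp add: corner_KQ)
qed

text \<open>Any element of the corner with matrix \<open>L\<close> represents the image of
  \<open>L\<close>, so each law for \<open>phi\<close> reduces to an identity for
  \<open>mat\<close>.\<close>

lemma gam_eq_phi:
  assumes "(g :: path \<Rightarrow> 'a::field) \<in> corner n D (frozen n) (frozen n)" "mat g = L"
  shows "gam_eq n D (phi L) g" "gam_eq n D g (phi L)" "L \<in> Lambda n"
  using assms mat_in_Lambda[OF corner_KQ[OF assms(1)]] gam_eq_iff_mat phi by metis+

lemma gam_eq_psi:
  assumes "(s,t) \<in> edges n D" "(g :: path \<Rightarrow> 'a::field) \<in> corner n D (frozen n) {(s,t)}" "vec (s,t) g = v"
  shows "gam_eq n D (psi (s,t) v) g" "gam_eq n D g (psi (s,t) v)" "v \<in> stmod n s t"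
  using assms vec_in_stmod[OF corner_KQ[OF assms(2)]] gam_eq_iff_vec psi by metis+

lemma R_order_iso_phi: "R_order_iso n D (phi :: _ \<Rightarrow> path \<Rightarrow> 'a::field)"
  unfolding R_order_iso_def
proof (intro conjI ballI allI impI)
  fix L M :: "nat \<Rightarrow> nat \<Rightarrow> 'a poly fract" assume L: "L \<in> Lambda n" and M: "M \<in> Lambda n"
  show "phi L \<in> corner n D (frozen n) (frozen n)" using phi L by blast
  show "gam_eq n D (phi (madd L M)) (kq_add (phi L) (phi M))"
    by (intro gam_eq_phi corner_add) (simp_all add: phi L M mat_add)
  show "gam_eq n D (phi (mmult n L M)) (kq_mult (phi L) (phi M))"
    by (intro gam_eq_phi corner_mult[of _ _ _ _ "frozen n"]) (simp_all add: phi L M mat_mult)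
  show "L = M" if "gam_eq n D (phi L) (phi M)"
    using that gam_eq_iff_mat[OF phi(1)[OF L] phi(1)[OF M]] phi(3)[OF L] phi(3)[OF M] by simp
next
  show "gam_eq n D (phi (mone n)) (idem (frozen n) :: path \<Rightarrow> 'a)"
    by (intro gam_eq_phi idem_corner mat_idem)
next
  fix r :: "'a poly" and L :: "nat \<Rightarrow> nat \<Rightarrow> 'a poly fract" assume L: "L \<in> Lambda n"
  show "gam_eq n D (phi (msmul r L)) (kq_smul_poly n D r (phi L))"
    by (intro gam_eq_phi kq_smul_poly_corner) (simp_all add: phi L mat_smul)
next
  fix g :: "path \<Rightarrow> 'a" assume "g \<in> corner n D (frozen n) (frozen n)"
  then show "\<exists>L\<in>Lambda n. gam_eq n D g (phi L)" using gam_eq_phi by blast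
qed

lemma module_iso_psi:
  assumes e: "(s,t) \<in> edges n D"
  shows "module_iso n D (phi :: _ \<Rightarrow> path \<Rightarrow> 'a::field) s t (psi (s,t))"
  unfolding module_iso_def
proof (intro conjI ballI impI)
  fix v w :: "nat \<Rightarrow> 'a poly fract" assume v: "v \<in> stmod n s t" and w: "w \<in> stmod n s t"
  show "psi (s,t) v \<in> corner n D (frozen n) {(s,t)}" using psi e v by blast
  show "gam_eq n D (psi (s,t) (vadd v w)) (kq_add (psi (s,t) v) (psi (s,t) w))"
    by (intro gam_eq_psi corner_add e) (simp_all add: psi e v w vec_add)
  show "v = w" if "gam_eq n D (psi (s,t) v) (psi (s,t) w)"
    using that gam_eq_iff_vec[OF psi(1)[OF e v] psi(1)[OF e w]] psi(3)[OF e v] psi(3)[OF e w] by simp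
next
  fix L :: "nat \<Rightarrow> nat \<Rightarrow> 'a poly fract" and v :: "nat \<Rightarrow> 'a poly fract" assume L: "L \<in> Lambda n" and v: "v \<in> stmod n s t"
  show "gam_eq n D (psi (s,t) (mvec n L v)) (kq_mult (phi L) (psi (s,t) v))"
    by (intro gam_eq_psi corner_mult[of _ _ _ _ "frozen n"] e) (simp_all add: psi e v phi L vec_mult)
next
  fix g :: "path \<Rightarrow> 'a" assume "g \<in> corner n D (frozen n) {(s,t)}"
  then show "\<exists>v\<in>stmod n s t. gam_eq n D g (psi (s,t) v)" using gam_eq_psi[OF e] by blast
qed

end

theorem theorem3p8:
  fixes n :: nat and D :: "edge set"
  assumes "n \<ge> 3" and "is_triangulation n D"
  shows "\<exists>\<phi> :: (nat \<Rightarrow> nat \<Rightarrow> 'a::field poly fract) \<Rightarrow> (path \<Rightarrow> 'a).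
           R_order_iso n D \<phi> \<and>
           (\<forall>s t. (s,t) \<in> edges n D \<longrightarrow> (\<exists>\<psi>. module_iso n D \<phi> s t \<psi>))"
proof -
  interpret triangulated_polygon n D by unfold_locales (fact assms)+
  show ?thesis using R_order_iso_phi module_iso_psi by blast
qed

end
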